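(* Suppose that (A1) and (A2) of the context hold. If $\nu_n/n\to0$, then $\|\hat{\boldsymbol\theta}_n-\boldsymbol\theta_0\|\to 0$ in probability as $n\to\infty$.
   Context: Triangular array setting: for each $n$, $\mathbf Z_1,\dots,\mathbf Z_n\in\mathbb R^{m_n}$ are i.i.d. from a probability measure $\mathbb P$ (which may change with $n$), and $\mathcal F=\{f(\cdot,\cdot;\boldsymbol\theta):\boldsymbol\theta\in\Theta\subset\mathbb R^{p_n}\}$ is a class of real-valued, possibly asymmetric and possibly discontinuous functions on $\mathbb R^{m_n}\times\mathbb R^{m_n}$; $m_n,p_n,\nu_n$ may tend to infinity. $\mathcal F$ is a VC-subgraph class of VC-dimension $\nu_n$, uniformly bounded by an absolute constant (a constant not depending on $n$). Let $$\Gamma_n(\boldsymbol\theta)=\frac1{n(n-1)}\sum_{i\ne j}f(\mathbf Z_i,\mathbf Z_j;\boldsymbol\theta),\quad \hat{\boldsymbol\theta}_n=\arg\max_{\boldsymbol\theta\in\Theta}\Gamma_n(\boldsymbol\theta),\quad \Gamma(\boldsymbol\theta)=\mathbb E\Gamma_n(\boldsymbol\theta),\quad \boldsymbol\theta_0=\arg\max_{\boldsymbol\theta\in\Theta}\Gamma(\boldsymbol\theta).$$ It is assumed (without loss of generality) that $f(\mathbf z_1,\mathbf z_2;\boldsymbol\theta_0)=0$ for all $\mathbf z_1,\mathbf z_2$. $\|\cdot\|$ is the Euclidean norm and $\mathcal B(\boldsymbol\theta_0,r)=\{\boldsymbol\theta\in\Theta:\|\boldsymbol\theta-\boldsymbol\theta_0\|<r\}$.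 (A1) For each $p_n$, $\Theta$ is a compact subset of $\mathbb R^{p_n}$, and there is an absolute constant $r_0>0$ such that the Euclidean ball $\{\boldsymbol\theta\in\mathbb R^{p_n}:\|\boldsymbol\theta-\boldsymbol\theta_0\|<r_0\}$ is contained in $\Theta$ and, for any positive absolute constant $r<r_0$, there is an absolute constant $\xi_0>0$ depending on $r$ with $\Gamma(\boldsymbol\theta_0)-\max_{\boldsymbol\theta\in\Theta\setminus\mathcal B(\boldsymbol\theta_0,r)}\Gamma(\boldsymbol\theta)\ge\xi_0$. (A2) $\Gamma$ is continuous at every $\boldsymbol\theta\in\Theta$, and $f(\cdot,\cdot;\boldsymbol\theta)$ is almost everywhere continuous at $\boldsymbol\theta_0$ (i.e. for almost every $(\mathbf z_1,\mathbf z_2)$ under $\mathbb P\otimes\mathbb P$, $\boldsymbol\theta\mapsto f(\mathbf z_1,\mathbf z_2;\boldsymbol\theta)$ is continuous at $\boldsymbol\theta_0$).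
   Formalization: The formal theorem also assumes that f(z1,z2;θ) is jointly Borel measurable in (z1,z2,θ), without which the claim can fail, and that the estimator is a measurable function of the sample. *)

theory Defs
  imports "HOL-Probability.Probability"
begin

section \<open>Euclidean spaces of varying dimension\<close>

text \<open>
  The dimensions depend on \<open>n\<close>, so \<open>\<real>\<^sup>k\<close> cannot be a type. It is represented by the functions
  \<open>{..<k} \<rightarrow>\<^sub>E UNIV\<close>, which is both the \<^const>\<open>topspace\<close> of \<open>rvec_top k\<close> and the \<^const>\<open>space\<close> of
  \<open>rvec_borel k\<close>. As the index set is finite, the product topology is the Euclidean topology and
  the product sigma-algebra is its Borel sigma-algebra.
\<close>

type_synonym rvec = "nat \<Rightarrow> real"

abbreviation rvec_top :: "nat \<Rightarrow> rvec topology" where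
  "rvec_top k \<equiv> product_topology (\<lambda>_. euclideanreal) {..<k}"

abbreviation rvec_borel :: "nat \<Rightarrow> rvec measure" where
  "rvec_borel k \<equiv> PiM {..<k} (\<lambda>_. borel)"

definition eucl_dist :: "nat \<Rightarrow> rvec \<Rightarrow> rvec \<Rightarrow> real" where
  "eucl_dist k x y = L2_set (\<lambda>i. x i - y i) {..<k}"

definition eucl_ball :: "nat \<Rightarrow> rvec \<Rightarrow> real \<Rightarrow> rvec set" where
  "eucl_ball k c r = {x \<in> topspace (rvec_top k). eucl_dist k x c < r}"

section \<open>VC-subgraph classes\<close>

definition shatters :: "'a set set \<Rightarrow> 'a set \<Rightarrow> bool" where
  "shatters \<C> A \<longleftrightarrow> (\<forall>B \<subseteq> A. \<exists>S \<in> \<C>. S \<inter> A = B)"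

text \<open>
  The VC-dimension is the largest cardinality of a shattered set (some authors use the smallest
  cardinality at which no set is shattered, which is larger by one).
\<close>

definition has_vc_dim :: "'a set set \<Rightarrow> nat \<Rightarrow> bool" where
  "has_vc_dim \<C> \<nu> \<longleftrightarrow>
     (\<exists>A. finite A \<and> card A = \<nu> \<and> shatters \<C> A) \<and>
     (\<forall>A. finite A \<and> shatters \<C> A \<longrightarrow> card A \<le> \<nu>)"

definition subgraph :: "'a set \<Rightarrow> ('a \<Rightarrow> real) \<Rightarrow> ('a \<times> real) set" where
  "subgraph X g = {(x, t). x \<in> X \<and> t < g x}"

definition vc_subgraph_class :: "'a set \<Rightarrow> ('a \<Rightarrow> real) set \<Rightarrow> nat \<Rightarrow> bool" where
  "vc_subgraph_class X \<F> \<nu> \<longleftrightarrow> has_vc_dim (subgraph X ` \<F>) \<nu>"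

section \<open>The criterion and its expectation\<close>

definition U_stat :: "nat \<Rightarrow> ('z \<Rightarrow> 'z \<Rightarrow> 't \<Rightarrow> real) \<Rightarrow> (nat \<Rightarrow> 'z) \<Rightarrow> 't \<Rightarrow> real" where
  "U_stat n h z \<theta> =
     (\<Sum>(i, j) \<in> {(i, j). i < n \<and> j < n \<and> i \<noteq> j}. h (z i) (z j) \<theta>) / (real n * (real n - 1))"

definition expected_U_stat ::
  "'w measure \<Rightarrow> nat \<Rightarrow> ('z \<Rightarrow> 'z \<Rightarrow> 't \<Rightarrow> real) \<Rightarrow> (nat \<Rightarrow> 'w \<Rightarrow> 'z) \<Rightarrow> 't \<Rightarrow> real" where
  "expected_U_stat M n h Z \<theta> = (\<integral>\<omega>. U_stat n h (\<lambda>i. Z i \<omega>) \<theta> \<partial>M)"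

definition sample :: "nat \<Rightarrow> (nat \<Rightarrow> 'w \<Rightarrow> 'z) \<Rightarrow> 'w \<Rightarrow> (nat \<Rightarrow> 'z)" where
  "sample n Z \<omega> = (\<lambda>i\<in>{..<n}. Z i \<omega>)"

end

theory Submission
  imports Defs "HOL-Combinatorics.Permutations"
begin

text \<open>
  Averaging over permutations of the sample writes the U-statistic as a mean of averages over
  \<open>n div 2\<close> disjoint, hence independent, pairs. For each such average, exchanging pairs with a ghost
  sample bounds the expected deviation at any measurable data-dependent parameter by the Rademacher
  complexity of the class on fixed points. Slicing the functions into \<open>K\<close> levels reduces this to
  set classes of VC-dimension at most \<open>\<nu>\<close>, to which the Sauer-Shelah and Massart lemmas apply; the
  result is of order \<open>1 / K + K * ln K * \<nu> / n\<close>, which tends to 0 as first \<open>n\<close> and then \<open>K\<close> grow.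
  On the event that the estimator is far from \<open>\<theta>0\<close> the deviation of the criterion is at least the
  separation constant of (A1), so Markov's inequality bounds the probability of the event.
\<close>

section \<open>Rademacher complexity of VC classes of sets\<close>

text \<open>Since \<open>f\<close> may be discontinuous in the parameter, the supremum of the
  deviations over \<open>\<Theta>\<close> need not be measurable. The deviation is therefore
  integrated at a single measurable function \<open>T\<close> of the whole sample: a ghost pair is
  independent of that sample, so integrating it out leaves exactly the mean criterion at
  \<open>T\<close>. Exchanging pairs also changes the argument of \<open>T\<close>, so the parameter
  comes to depend on the signs. This is why the Rademacher bounds are stated for an arbitrary
  selection \<open>sel\<close> that may depend on the sign vector; it plays the role of the
  supremum. The bound holds for each permutation separately with the same \<open>T\<close>, so
  \<open>T\<close> may depend on the order of the sample. Only upper deviations are controlled. They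
  suffice because the sample criterion and its mean both vanish at \<open>\<theta>0\<close>, while
  the criterion at the maximizer is nonnegative.\<close>

lemma card_le_card_shattered:
  fixes U :: "'a set"
  assumes "finite U" "\<C> \<subseteq> Pow U"
  shows "card \<C> \<le> card {A \<in> Pow U. shatters \<C> A}"
  using assms
proof (induction U arbitrary: \<C> rule: finite_induct)
  case empty
  show ?case
  proof (rule card_mono)
    show "finite {A \<in> Pow {}. shatters \<C> A}"
      by (rule finite_subset[OF Collect_restrict]) simp
    show "\<C> \<subseteq> {A \<in> Pow {}. shatters \<C> A}"
    proof
      fix S assume S: "S \<in> \<C>"
      then have "S = {}" using empty by blast
      then show "S \<in> {A \<in> Pow {}. shatters \<C> A}"
        using S unfolding shatters_def by blast
    qed
  qed
next
  case (insert x U)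
  \<comment> \<open>Pajor's induction: \<open>C0\<close> is the trace on \<open>U\<close>, and
    \<open>C1\<close> collects the traces that occur both with and without \<open>x\<close>, so the
    cardinality of \<open>\<C>\<close> is the sum of theirs. A subset of \<open>U\<close> shattered
    by \<open>C0\<close> is shattered by \<open>\<C>\<close>; one shattered by \<open>C1\<close>
    stays shattered by \<open>\<C>\<close> after adding \<open>x\<close>. The two kinds are
    distinct, as only the latter contain \<open>x\<close>.\<close>
  define C0 where "C0 = (\<lambda>S. S - {x}) ` \<C>"
  define C1 where "C1 = {S \<in> Pow U. S \<in> \<C> \<and> insert x S \<in> \<C>}"
  define sh where "sh V D = {A \<in> Pow V. shatters D A}" for V :: "'a set" and D
  have fin: "finite \<C>"
    using insert.prems insert.hyps(1) by (meson finite.insertI finite_Pow_iff finite_subset)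
  have fin0: "finite C0" and fin1: "finite C1"
    using fin insert.hyps(1) unfolding C0_def C1_def by auto
  have C0: "C0 \<subseteq> Pow U" and C1: "C1 \<subseteq> Pow U"
    using insert.prems unfolding C0_def C1_def by auto
  have finsh: "finite (sh V D)" if "finite V" for V D
    using that unfolding sh_def by simp
  define a where "a = {S \<in> \<C>. x \<notin> S}"
  define b where "b = {S \<in> \<C>. x \<in> S}"
  have ab: "\<C> = a \<union> b" "a \<inter> b = {}" unfolding a_def b_def by blast+
  have finab: "finite a" "finite b" using fin unfolding a_def b_def by simp_all
  have card_C: "card \<C> = card a + card b"
    unfolding ab(1) by (rule card_Un_disjoint[OF finab ab(2)])
  have card_b: "card b = card ((\<lambda>S. S - {x}) ` b)"
    by (rule card_image[symmetric]) (auto simp: inj_on_def b_def)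
  have card_ab: "card a + card ((\<lambda>S. S - {x}) ` b) = card (a \<union> (\<lambda>S. S - {x}) ` b) + card (a \<inter> (\<lambda>S. S - {x}) ` b)"
    using finab by (intro card_Un_Int) simp_all
  have union: "a \<union> (\<lambda>S. S - {x}) ` b = C0"
  proof -
    have "(\<lambda>S. S - {x}) ` a = id ` a"
      by (rule image_cong) (auto simp: a_def)
    then show ?thesis unfolding C0_def ab(1) image_Un by simp
  qed
  have inter: "a \<inter> (\<lambda>S. S - {x}) ` b = C1"
  proof (intro set_eqI iffI)
    fix S assume S: "S \<in> a \<inter> (\<lambda>S. S - {x}) ` b"
    then obtain T where T: "T \<in> \<C>" "x \<in> T" "S = T - {x}" unfolding b_def by blast
    have "insert x S \<in> \<C>" using T by (simp add: insert_absorb)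
    moreover have "S \<in> \<C>" using S by (simp add: a_def)
    moreover have "S \<subseteq> U" using T insert.prems by blast
    ultimately show "S \<in> C1" by (simp add: C1_def)
  next
    fix S assume S: "S \<in> C1"
    then have "x \<notin> S" using insert.hyps(2) unfolding C1_def by blast
    then have "S = insert x S - {x}" by blast
    moreover have "insert x S \<in> b" "S \<in> a" using S \<open>x \<notin> S\<close> by (simp_all add: a_def b_def C1_def)
    ultimately show "S \<in> a \<inter> (\<lambda>S. S - {x}) ` b" by (intro IntI image_eqI)
  qed
  have IH: "card C0 + card C1 \<le> card (sh U C0) + card (sh U C1)"
    using insert.IH[OF C0] insert.IH[OF C1] by (simp add: sh_def)
  have card_ins: "card (sh U C1) = card (insert x ` sh U C1)"
  proof (rule card_image[symmetric], rule inj_onI)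
    fix A B assume "A \<in> sh U C1" "B \<in> sh U C1" and eq: "insert x A = insert x B"
    then have "x \<notin> A" "x \<notin> B" using insert.hyps(2) unfolding sh_def by blast+
    then show "A = B" using eq by (simp add: insert_ident)
  qed
  have card_sh: "card (sh U C0) + card (insert x ` sh U C1) = card (sh U C0 \<union> insert x ` sh U C1)"
  proof (rule card_Un_disjoint[symmetric])
    show "finite (sh U C0)" "finite (insert x ` sh U C1)"
      using insert.hyps(1) by (simp_all add: finsh)
    have "x \<notin> A" if "A \<in> sh U C0" for A
      using that insert.hyps(2) unfolding sh_def by blast
    then show "sh U C0 \<inter> insert x ` sh U C1 = {}" by blast
  qed
  have sh_le: "card (sh U C0 \<union> insert x ` sh U C1) \<le> card (sh (insert x U) \<C>)"
  proof (intro card_mono finsh)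
    show "finite (insert x U)" using insert.hyps by simp
    have "shatters \<C> A" if A: "A \<subseteq> U" "shatters C0 A" for A
      unfolding shatters_def
    proof (intro allI impI)
      fix B assume "B \<subseteq> A"
      then have "\<exists>S\<in>C0. S \<inter> A = B" using A(2)[unfolded shatters_def] by simp
      then obtain S where "S \<in> \<C>" "(S - {x}) \<inter> A = B"
        unfolding C0_def by (elim bexE imageE) simp
      moreover from this have "S \<inter> A = B" using A(1) insert.hyps(2) by blast
      ultimately show "\<exists>S\<in>\<C>. S \<inter> A = B" by (intro bexI)
    qed
    moreover have "shatters \<C> (insert x A)" if A: "A \<subseteq> U" "shatters C1 A" for A
      unfolding shatters_def
    proof (intro allI impI)
      fix B assume B: "B \<subseteq> insert x A"
      then have "B - {x} \<subseteq> A" by auto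
      then obtain S where S: "S \<in> C1" "S \<inter> A = B - {x}"
        using A(2)[unfolded shatters_def, rule_format] by blast
      have xS: "x \<notin> S" "x \<notin> A" using S(1) A(1) insert.hyps(2) by (auto simp: C1_def)
      show "\<exists>S\<in>\<C>. S \<inter> insert x A = B"
      proof (cases "x \<in> B")
        case True
        then have "insert x S \<inter> insert x A = B" using S(2) B by auto
        moreover have "insert x S \<in> \<C>" using S(1) unfolding C1_def by simp
        ultimately show ?thesis by (intro bexI)
      next
        case False
        then have "S \<inter> insert x A = B" using S(2) xS by auto
        moreover have "S \<in> \<C>" using S(1) unfolding C1_def by simp
        ultimately show ?thesis by (intro bexI)
      qed
    qed
    ultimately show "sh U C0 \<union> insert x ` sh U C1 \<subseteq> sh (insert x U) \<C>"
      unfolding sh_def by blast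
  qed
  have "card \<C> \<le> card (sh (insert x U) \<C>)"
    using card_C card_b card_ab IH card_ins card_sh sh_le unfolding union inter by linarith
  then show ?case unfolding sh_def .
qed

text \<open>A Chernoff argument for counting: each admissible set has weight
  \<open>x ^ card A\<close> at least \<open>x ^ d\<close>, and the weights of all subsets sum to
  \<open>(1 + x) ^ card U\<close>. Taking \<open>x = d / card U\<close> would give the usual bound
  \<open>(e * card U / d) ^ d\<close>.\<close>

lemma card_bounded_subsets_le:
  fixes x :: real
  assumes "finite U" "0 < x" "x \<le> 1"
  shows "real (card {A \<in> Pow U. card A \<le> d}) \<le> (1 + x) ^ card U / x ^ d"
proof -
  have "real (card {A \<in> Pow U. card A \<le> d}) * x ^ d = (\<Sum>A\<in>{A \<in> Pow U. card A \<le> d}. x ^ d)"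
    by simp
  also have "\<dots> \<le> (\<Sum>A\<in>{A \<in> Pow U. card A \<le> d}. x ^ card A)"
    using assms by (intro sum_mono power_decreasing) auto
  also have "\<dots> \<le> (\<Sum>A\<in>Pow U. x ^ card A)"
    using assms by (intro sum_mono2) auto
  also have "\<dots> = (\<Prod>i\<in>U. x + 1)"
    by (subst prod_add[OF assms(1)]) simp
  finally show ?thesis
    using assms by (simp add: field_simps)
qed

text \<open>The parameter \<open>x\<close> stays free. The logarithm of the bound is at most
  \<open>card U * x + d * ln (1 / x)\<close>, so an \<open>x\<close> chosen independently of
  \<open>card U\<close> gives a small linear term in place of a factor \<open>ln (card U)\<close> on
  \<open>d\<close>.\<close>

lemma sauer_shelah:
  fixes x :: real
  assumes U: "finite U" "\<C> \<subseteq> Pow U"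
    and x: "0 < x" "x \<le> 1"
    and vc: "\<And>A. A \<subseteq> U \<Longrightarrow> shatters \<C> A \<Longrightarrow> card A \<le> d"
  shows "real (card \<C>) \<le> (1 + x) ^ card U / x ^ d"
proof -
  have "card \<C> \<le> card {A \<in> Pow U. shatters \<C> A}"
    by (rule card_le_card_shattered[OF U])
  also have "\<dots> \<le> card {A \<in> Pow U. card A \<le> d}"
    using U vc by (intro card_mono) auto
  finally show ?thesis
    using card_bounded_subsets_le[OF U(1) x, of d] by linarith
qed

text \<open>A sign vector on \<open>{..<N}\<close> is encoded by the set of its negative positions.\<close>

definition rademacher :: "nat set \<Rightarrow> nat \<Rightarrow> real" where
  "rademacher A i = (if i \<in> A then -1 else 1)"

section \<open>Exponential moments of Rademacher sums and Massart's lemma\<close>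

lemma cosh_le_exp_square:
  fixes l :: real
  assumes "0 \<le> l" "l \<le> 1"
  shows "exp l + exp (- l) \<le> 2 * exp (l\<^sup>2)"
proof -
  have "exp (- l) = 1 / exp l" by (simp add: exp_minus field_simps)
  also have "\<dots> \<le> 1 / (1 + l)"
    using assms by (intro divide_left_mono) (auto intro: mult_pos_pos simp: exp_ge_add_one_self)
  \<comment> \<open>\<open>(1 + l) * (1 - l + l\<^sup>2) = 1 + l ^ 3\<close>, which is at least
    1.\<close>
  also have "\<dots> \<le> 1 - l + l\<^sup>2"
    using assms by (simp add: field_simps power2_eq_square)
  finally have "exp l + exp (- l) \<le> (1 + l + l\<^sup>2) + (1 - l + l\<^sup>2)"
    using exp_bound[OF assms] by (intro add_mono)
  also have "\<dots> = 2 * (1 + l\<^sup>2)" by simp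
  also have "\<dots> \<le> 2 * exp (l\<^sup>2)"
    by (intro mult_left_mono exp_ge_add_one_self) simp
  finally show ?thesis .
qed

text \<open>Independence of the signs in combinatorial form: expanding a product of \<open>N\<close>
  two-term sums gives exactly the sum over all sign sets. An index outside \<open>C\<close>
  contributes the factor 2, which \<open>2 * exp (l\<^sup>2)\<close> also covers; hence
  \<open>N\<close> rather than \<open>card C\<close> in the bound.\<close>

lemma rademacher_mgf_le:
  assumes "0 \<le> l" "l \<le> 1" "C \<subseteq> {..<N}"
  shows "(\<Sum>A\<in>Pow {..<N}. exp (l * (\<Sum>i\<in>C. rademacher A i))) \<le> 2 ^ N * exp (real N * l\<^sup>2)"
proof -
  have "(\<Sum>A\<in>Pow {..<N}. exp (l * (\<Sum>i\<in>C. rademacher A i))) =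
      (\<Sum>A\<in>Pow {..<N}. (\<Prod>i\<in>A. exp (- l * of_bool (i \<in> C))) * (\<Prod>i\<in>{..<N} - A. exp (l * of_bool (i \<in> C))))"
  proof (intro sum.cong refl)
    fix A assume A: "A \<in> Pow {..<N}"
    have "(\<Sum>i\<in>C. rademacher A i) = (\<Sum>i<N. rademacher A i * of_bool (i \<in> C))"
      using assms(3) by (simp add: sum.inter_restrict[symmetric] Int_absorb1 of_bool_def if_distrib cong: if_cong)
    also have "\<dots> = (\<Sum>i\<in>A. rademacher A i * of_bool (i \<in> C)) + (\<Sum>i\<in>{..<N} - A. rademacher A i * of_bool (i \<in> C))"
      using A by (subst add.commute, intro sum.subset_diff) auto
    also have "\<dots> = (\<Sum>i\<in>A. - of_bool (i \<in> C)) + (\<Sum>i\<in>{..<N} - A. of_bool (i \<in> C))"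
      by (intro arg_cong2[where f = "(+)"] sum.cong) (auto simp: rademacher_def)
    finally have split: "(\<Sum>i\<in>C. rademacher A i) =
        (\<Sum>i\<in>A. - of_bool (i \<in> C)) + (\<Sum>i\<in>{..<N} - A. of_bool (i \<in> C))" .
    have *: "l * (\<Sum>i\<in>C. rademacher A i) =
        (\<Sum>i\<in>A. - l * of_bool (i \<in> C)) + (\<Sum>i\<in>{..<N} - A. l * of_bool (i \<in> C))"
      unfolding split distrib_left sum_distrib_left by (simp only: mult_minus_left mult_minus_right)
    have "finite A" using A finite_subset by auto
    then show "exp (l * (\<Sum>i\<in>C. rademacher A i)) =
        (\<Prod>i\<in>A. exp (- l * of_bool (i \<in> C))) * (\<Prod>i\<in>{..<N} - A. exp (l * of_bool (i \<in> C)))"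
      unfolding * exp_add by (subst (1 2) exp_sum) auto
  qed
  also have "\<dots> = (\<Prod>i<N. exp (- l * of_bool (i \<in> C)) + exp (l * of_bool (i \<in> C)))"
    by (rule prod_add[symmetric]) simp
  also have "\<dots> \<le> (\<Prod>i<N. 2 * exp (l\<^sup>2))"
    using cosh_le_exp_square[OF assms(1,2)]
    by (intro prod_mono) (auto simp: of_bool_def add_nonneg_nonneg add.commute)
  also have "\<dots> = 2 ^ N * exp (real N * l\<^sup>2)"
    by (simp add: power_mult_distrib exp_of_nat_mult)
  finally show ?thesis .
qed

text \<open>Choosing for \<open>sel A\<close> a set that maximizes the sum gives the usual expected
  maximum over the class. The value of \<open>l\<close> is not optimized, because it will be tied to
  the number of levels.\<close>

lemma massart_finite_class:
  assumes l: "0 < l" "l \<le> 1"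
    and \<C>: "\<C> \<subseteq> Pow {..<N}" "real (card \<C>) \<le> exp c"
    and sel: "\<And>A. A \<subseteq> {..<N} \<Longrightarrow> sel A \<in> \<C>"
  shows "(\<Sum>A\<in>Pow {..<N}. \<Sum>i\<in>sel A. rademacher A i) \<le> 2 ^ N * (c / l + real N * l)"
proof -
  \<comment> \<open>\<open>exp d\<close> bounds the mean over all sign sets of the exponentials
    summed over the class. The tangent of \<open>exp\<close>, in the form
    \<open>t \<le> d - 1 + exp (t - d)\<close>, replaces Jensen's inequality, and with this
    \<open>d\<close> the final bound collapses to \<open>d\<close>.\<close>
  define d where "d = c + real N * l\<^sup>2"
  have fin: "finite \<C>" using \<C>(1) by (rule finite_subset) simp
  define T where "T A C = (\<Sum>i\<in>C. rademacher A i)" for A C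
  have "(\<Sum>A\<in>Pow {..<N}. l * T A (sel A)) \<le> (\<Sum>A\<in>Pow {..<N}. d - 1 + exp (- d) * exp (l * T A (sel A)))"
  proof (intro sum_mono)
    fix A
    show "l * T A (sel A) \<le> d - 1 + exp (- d) * exp (l * T A (sel A))"
      using exp_ge_add_one_self[of "l * T A (sel A) - d"] by (simp add: exp_diff exp_minus field_simps)
  qed
  also have "\<dots> = 2 ^ N * (d - 1) + exp (- d) * (\<Sum>A\<in>Pow {..<N}. exp (l * T A (sel A)))"
    by (simp add: sum.distrib sum_distrib_left card_Pow del: card_UNIV_unit)
  \<comment> \<open>One member of the class is bounded by the sum over all of them. The sets no
    longer depend on the signs afterwards, so the moment bound applies to each.\<close>
  also have "(\<Sum>A\<in>Pow {..<N}. exp (l * T A (sel A))) \<le> (\<Sum>A\<in>Pow {..<N}. \<Sum>C\<in>\<C>. exp (l * T A C))"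
    using sel fin by (intro sum_mono member_le_sum) auto
  also have "\<dots> = (\<Sum>C\<in>\<C>. \<Sum>A\<in>Pow {..<N}. exp (l * T A C))"
    by (rule sum.swap)
  also have "\<dots> \<le> (\<Sum>C\<in>\<C>. 2 ^ N * exp (real N * l\<^sup>2))"
    unfolding T_def using l \<C>(1) by (intro sum_mono rademacher_mgf_le) auto
  also have "\<dots> \<le> exp c * (2 ^ N * exp (real N * l\<^sup>2))"
    using \<C>(2) by simp
  also have "\<dots> = 2 ^ N * exp d"
    by (simp add: d_def exp_add)
  finally have "(\<Sum>A\<in>Pow {..<N}. l * T A (sel A)) \<le> 2 ^ N * (d - 1) + exp (- d) * (2 ^ N * exp d)"
    by simp
  also have "\<dots> = 2 ^ N * d"
    by (simp add: exp_minus field_simps)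
  finally have "l * (\<Sum>A\<in>Pow {..<N}. T A (sel A)) \<le> 2 ^ N * d"
    by (simp add: sum_distrib_left)
  then have "(\<Sum>A\<in>Pow {..<N}. T A (sel A)) \<le> 2 ^ N * d / l"
    using l by (simp add: field_simps)
  also have "2 ^ N * d / l = 2 ^ N * (c / l + real N * l)"
    using l by (simp add: d_def field_simps power2_eq_square)
  finally show ?thesis unfolding T_def .
qed

section \<open>VC-subgraph classes of functions and U-statistics\<close>

text \<open>A shattered set of indices lifts to the points \<open>(u i, t)\<close>, all at the same
  height, which the subgraphs shatter. The points \<open>u i\<close> may repeat in general, but not
  on \<open>A\<close>: some level set separates each index from the others.\<close>

lemma card_shattered_level_sets_le:
  assumes vc: "vc_subgraph_class X \<F> \<nu>" and u: "u \<in> I \<rightarrow> X"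
    and A: "A \<subseteq> I" "finite A" "shatters ((\<lambda>g. {i \<in> I. t < g (u i)}) ` \<F>) A"
  shows "card A \<le> \<nu>"
proof -
  let ?w = "\<lambda>i. (u i, t)"
  have mem: "?w i \<in> subgraph X g \<longleftrightarrow> t < g (u i)" if "i \<in> A" for i g
  proof -
    have "u i \<in> X" using that A(1) u by (auto dest: funcset_mem)
    then show ?thesis by (simp add: subgraph_def)
  qed
  have sel: "\<exists>g\<in>\<F>. \<forall>i\<in>A. i \<in> B \<longleftrightarrow> t < g (u i)" if "B \<subseteq> A" for B
  proof -
    have "\<exists>S\<in>(\<lambda>g. {i \<in> I. t < g (u i)}) ` \<F>. S \<inter> A = B"
      using A(3)[unfolded shatters_def, rule_format, OF that] .
    then obtain g where g: "g \<in> \<F>" "{i \<in> I. t < g (u i)} \<inter> A = B" by (elim bexE imageE) simp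
    have "i \<in> B \<longleftrightarrow> t < g (u i)" if "i \<in> A" for i
      unfolding g(2)[symmetric] using that A(1) by auto
    then show ?thesis using g(1) by (intro bexI ballI)
  qed
  have inj: "inj_on ?w A"
  proof (rule inj_onI)
    fix i j assume ij: "i \<in> A" "j \<in> A" "?w i = ?w j"
    obtain g where g: "\<forall>k\<in>A. k \<in> {i} \<longleftrightarrow> t < g (u k)" using sel[of "{i}"] ij(1) by blast
    have "u i = u j" using ij(3) by simp
    then have "j \<in> {i}" using g[rule_format, OF ij(1)] g[rule_format, OF ij(2)] by simp
    then show "i = j" by simp
  qed
  have "shatters (subgraph X ` \<F>) (?w ` A)"
    unfolding shatters_def
  proof (intro allI impI)
    fix B assume B: "B \<subseteq> ?w ` A"
    obtain g where g: "g \<in> \<F>" "\<forall>i\<in>A. i \<in> {i \<in> A. ?w i \<in> B} \<longleftrightarrow> t < g (u i)"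
      using sel[OF Collect_restrict] by metis
    have *: "?w i \<in> subgraph X g \<longleftrightarrow> ?w i \<in> B" if "i \<in> A" for i
      unfolding mem[OF that] using g(2) that by blast
    have "subgraph X g \<inter> ?w ` A = B"
    proof (intro set_eqI iffI)
      fix s assume "s \<in> subgraph X g \<inter> ?w ` A"
      then show "s \<in> B" using * by (elim IntE imageE) simp
    next
      fix s assume s: "s \<in> B"
      then have "s \<in> ?w ` A" using B by (rule subsetD[rotated])
      with s show "s \<in> subgraph X g \<inter> ?w ` A" using * by (elim imageE) simp
    qed
    then show "\<exists>S\<in>subgraph X ` \<F>. S \<inter> ?w ` A = B" using g(1) by (intro bexI[of _ "subgraph X g"] imageI)
  qed
  then have "card (?w ` A) \<le> \<nu>"
    using vc[unfolded vc_subgraph_class_def has_vc_dim_def, THEN conjunct2, rule_format] A(2) by simp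
  then show ?thesis by (simp add: card_image[OF inj])
qed

text \<open>The number of levels strictly below \<open>y\<close> is the ceiling of
  \<open>(y + B) / \<delta>\<close> with \<open>\<delta> = 2 * B / K\<close>, and
  \<open>y \<le> B\<close> keeps it within \<open>K\<close>. Hence the staircase exceeds
  \<open>y\<close> by less than one step. The strict comparison is that of
  \<open>subgraph\<close>.\<close>

lemma level_discretization:
  fixes y B :: real
  assumes B: "0 < B" and y: "\<bar>y\<bar> \<le> B" and K: "K \<ge> 1"
  shows "\<bar>y - (- B + 2 * B / real K * real (card {k \<in> {..<K}. - B + 2 * B / real K * real k < y}))\<bar> \<le> 2 * B / real K"
proof -
  define \<delta> where "\<delta> = 2 * B / real K"
  define v where "v = (y + B) / \<delta>"
  have \<delta>: "\<delta> > 0" using B K by (simp add: \<delta>_def)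
  have yv: "y = - B + \<delta> * v" using \<delta> by (simp add: v_def)
  have v: "0 \<le> v" "v \<le> real K"
  proof -
    show "0 \<le> v" using y \<delta> unfolding v_def by (intro divide_nonneg_pos) linarith+
    have "real K * \<delta> = 2 * B" using K by (simp add: \<delta>_def)
    then show "v \<le> real K" using y unfolding v_def pos_divide_le_eq[OF \<delta>] by linarith
  qed
  have "{k \<in> {..<K}. - B + \<delta> * real k < y} = {..<nat \<lceil>v\<rceil>}"
  proof (intro set_eqI)
    fix k
    have "- B + \<delta> * real k < y \<longleftrightarrow> real k < v"
      unfolding v_def pos_less_divide_eq[OF \<delta>] by (auto simp: mult.commute)
    also have "\<dots> \<longleftrightarrow> int k < \<lceil>v\<rceil>" unfolding less_ceiling_iff by simp
    also have "\<dots> \<longleftrightarrow> k < nat \<lceil>v\<rceil>" by (rule zless_nat_eq_int_zless[symmetric])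
    finally have "- B + \<delta> * real k < y \<longleftrightarrow> k < nat \<lceil>v\<rceil>" .
    moreover have "nat \<lceil>v\<rceil> \<le> K" using v(2) unfolding nat_le_iff ceiling_le_iff by simp
    ultimately show "k \<in> {k \<in> {..<K}. - B + \<delta> * real k < y} \<longleftrightarrow> k \<in> {..<nat \<lceil>v\<rceil>}"
      unfolding mem_Collect_eq lessThan_iff by (meson order_less_le_trans)
  qed
  then have card: "card {k \<in> {..<K}. - B + \<delta> * real k < y} = nat \<lceil>v\<rceil>" by simp
  have "\<bar>v - real (nat \<lceil>v\<rceil>)\<bar> \<le> 1" using v(1) by linarith
  then have "\<delta> * \<bar>v - real (nat \<lceil>v\<rceil>)\<bar> \<le> \<delta> * 1" using \<delta> by (intro mult_left_mono) auto
  also have "\<delta> * \<bar>v - real (nat \<lceil>v\<rceil>)\<bar> = \<bar>\<delta> * (v - real (nat \<lceil>v\<rceil>))\<bar>"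
    unfolding abs_mult using \<delta> by simp
  also have "\<delta> * (v - real (nat \<lceil>v\<rceil>)) = y - (- B + \<delta> * real (nat \<lceil>v\<rceil>))"
    using yv by (simp add: right_diff_distrib)
  finally show ?thesis unfolding \<delta>_def[symmetric] card by simp
qed

text \<open>Complementation flips every sign. This removes the constant offset \<open>- B\<close> of
  the staircase from Rademacher sums.\<close>

lemma sum_rademacher_sets:
  assumes "i < N"
  shows "(\<Sum>A\<in>Pow {..<N}. rademacher A i) = 0"
proof -
  have "(\<Sum>A\<in>Pow {..<N}. rademacher A i) = (\<Sum>A\<in>Pow {..<N}. - rademacher A i)"
    by (rule sum.reindex_bij_witness[where i = "\<lambda>A. {..<N} - A" and j = "\<lambda>A. {..<N} - A"])
      (use assms in \<open>auto simp: rademacher_def\<close>)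
  then show ?thesis by (simp add: sum_negf)
qed

text \<open>\<open>N\<close> times the Rademacher bound obtained from \<open>K\<close> levels at distance \<open>2 * B / K\<close>, with
  \<open>l = 1 / K\<close> in Massart's lemma and \<open>x = 1 / K\<^sup>2\<close> in the Sauer-Shelah lemma. Since \<open>\<nu>\<close> enters
  without a factor \<open>ln N\<close>, the assumption \<open>\<nu> / n \<longlonglongrightarrow> 0\<close> suffices.\<close>

definition vc_rademacher_bound :: "real \<Rightarrow> nat \<Rightarrow> nat \<Rightarrow> nat \<Rightarrow> real" where
  "vc_rademacher_bound B K \<nu> N = 2 * B * (3 * real N / real K + 2 * real K * ln (real K) * real \<nu>)"

lemma rademacher_complexity_vc_subgraph:
  assumes vc: "vc_subgraph_class X \<F> \<nu>" and u: "u \<in> {..<N} \<rightarrow> X"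
    and B: "0 < B" "\<And>g x. g \<in> \<F> \<Longrightarrow> x \<in> X \<Longrightarrow> \<bar>g x\<bar> \<le> B"
    and K: "K \<ge> 1"
    and sel: "\<And>A. A \<subseteq> {..<N} \<Longrightarrow> sel A \<in> \<F>"
  shows "(\<Sum>A\<in>Pow {..<N}. \<Sum>i<N. rademacher A i * sel A (u i)) \<le> 2 ^ N * vc_rademacher_bound B K \<nu> N"
proof -
  define l where "l = 1 / real K"
  define \<delta> where "\<delta> = 2 * B / real K"
  define t where "t k = - B + \<delta> * real k" for k
  define C where "C k g = {i \<in> {..<N}. t k < g (u i)}" for k and g :: "'a \<Rightarrow> real"
  have l: "0 < l" "l \<le> 1" using K by (auto simp: l_def)
  have \<delta>: "\<delta> > 0" using B K by (simp add: \<delta>_def)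
  \<comment> \<open>Logarithm of the Sauer-Shelah bound at \<open>x = l\<^sup>2\<close>:
    \<open>(1 + l\<^sup>2) ^ N \<le> exp (N * l\<^sup>2)\<close>, and
    \<open>1 / l\<^sup>2 = K\<^sup>2\<close> costs \<open>2 * ln K\<close> per dimension.\<close>
  define c where "c = real N * l\<^sup>2 + 2 * ln (real K) * real \<nu>"
  have level: "(\<Sum>A\<in>Pow {..<N}. \<Sum>i\<in>C k (sel A). rademacher A i) \<le> 2 ^ N * (c / l + real N * l)" for k
  proof (rule massart_finite_class[OF l])
    show CC: "C k ` \<F> \<subseteq> Pow {..<N}" by (auto simp: C_def)
    show "C k (sel A) \<in> C k ` \<F>" if "A \<subseteq> {..<N}" for A using sel[OF that] by simp
    have "real (card (C k ` \<F>)) \<le> (1 + l\<^sup>2) ^ card {..<N} / (l\<^sup>2) ^ \<nu>"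
    proof (rule sauer_shelah[OF _ CC])
      show "0 < l\<^sup>2" "l\<^sup>2 \<le> 1" using l by (auto simp: power_le_one)
      fix A assume "A \<subseteq> {..<N}" "shatters (C k ` \<F>) A"
      then show "card A \<le> \<nu>"
        using card_shattered_level_sets_le[OF vc u, of A "t k"] finite_subset[of A "{..<N}"]
        unfolding C_def by auto
    qed simp
    also have "\<dots> \<le> exp (l\<^sup>2) ^ N * (exp (2 * ln (real K))) ^ \<nu>"
    proof -
      have "exp (2 * ln (real K)) = (real K)\<^sup>2" using K by (simp add: exp_double)
      then have "1 / l\<^sup>2 = exp (2 * ln (real K))" by (simp add: l_def power_divide)
      then have "(1 + l\<^sup>2) ^ card {..<N} / (l\<^sup>2) ^ \<nu> = (1 + l\<^sup>2) ^ N * (exp (2 * ln (real K))) ^ \<nu>"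
        by (metis card_lessThan divide_inverse inverse_eq_divide power_one_over)
      also have "\<dots> \<le> exp (l\<^sup>2) ^ N * (exp (2 * ln (real K))) ^ \<nu>"
        by (intro mult_right_mono power_mono exp_ge_add_one_self) auto
      finally show ?thesis .
    qed
    also have "\<dots> = exp c"
      by (simp add: c_def exp_add exp_of_nat_mult[symmetric] mult_ac)
    finally show "real (card (C k ` \<F>)) \<le> exp c" .
  qed
  have "(\<Sum>A\<in>Pow {..<N}. \<Sum>i<N. rademacher A i * sel A (u i)) \<le>
      (\<Sum>A\<in>Pow {..<N}. \<Sum>i<N. (- B) * rademacher A i + \<delta> * (\<Sum>k<K. if i \<in> C k (sel A) then rademacher A i else 0) + \<delta>)"
  proof (intro sum_mono)
    fix A i assume A: "A \<in> Pow {..<N}" and i: "i \<in> {..<N}"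
    let ?y = "sel A (u i)"
    have "\<bar>?y\<bar> \<le> B" using sel[of A] A funcset_mem[OF u i] by (intro B(2)) auto
    from level_discretization[OF B(1) this K]
    have "\<bar>?y - (- B + \<delta> * real (card {k \<in> {..<K}. t k < ?y}))\<bar> \<le> \<delta>"
      unfolding \<delta>_def t_def by simp
    then have "rademacher A i * ?y \<le> rademacher A i * (- B + \<delta> * real (card {k \<in> {..<K}. t k < ?y})) + \<delta>"
      by (auto simp: rademacher_def)
    also have "real (card {k \<in> {..<K}. t k < ?y}) = (\<Sum>k<K. if i \<in> C k (sel A) then 1 else 0)"
      using i by (simp add: C_def sum.If_cases Int_def)
    also have "rademacher A i * (- B + \<delta> * (\<Sum>k<K. if i \<in> C k (sel A) then 1 else 0)) =
        (- B) * rademacher A i + \<delta> * (\<Sum>k<K. if i \<in> C k (sel A) then rademacher A i else 0)"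
      by (simp add: algebra_simps sum_distrib_left if_distrib cong: if_cong)
    finally show "rademacher A i * ?y \<le> (- B) * rademacher A i + \<delta> * (\<Sum>k<K. if i \<in> C k (sel A) then rademacher A i else 0) + \<delta>" .
  qed
  also have "\<dots> = (- B) * (\<Sum>i<N. \<Sum>A\<in>Pow {..<N}. rademacher A i) +
      \<delta> * (\<Sum>k<K. \<Sum>A\<in>Pow {..<N}. \<Sum>i\<in>C k (sel A). rademacher A i) + 2 ^ N * real N * \<delta>"
  proof -
    have eq: "(\<Sum>i<N. if i \<in> C k (sel A) then rademacher A i else 0) = (\<Sum>i\<in>C k (sel A). rademacher A i)" for k A
      by (subst sum.inter_restrict[symmetric]) (auto simp: C_def intro!: sum.cong)
    have 1: "(\<Sum>A\<in>Pow {..<N}. \<Sum>i<N. (- B) * rademacher A i) = (- B) * (\<Sum>i<N. \<Sum>A\<in>Pow {..<N}. rademacher A i)"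
      unfolding sum_distrib_left by (rule sum.swap)
    have "(\<Sum>A\<in>Pow {..<N}. \<Sum>i<N. \<Sum>k<K. if i \<in> C k (sel A) then rademacher A i else 0) =
        (\<Sum>A\<in>Pow {..<N}. \<Sum>k<K. \<Sum>i<N. if i \<in> C k (sel A) then rademacher A i else 0)"
      by (intro sum.cong refl sum.swap)
    also have "\<dots> = (\<Sum>k<K. \<Sum>A\<in>Pow {..<N}. \<Sum>i<N. if i \<in> C k (sel A) then rademacher A i else 0)"
      by (rule sum.swap)
    finally have 2: "(\<Sum>A\<in>Pow {..<N}. \<Sum>i<N. \<Sum>k<K. if i \<in> C k (sel A) then rademacher A i else 0) =
       (\<Sum>k<K. \<Sum>A\<in>Pow {..<N}. \<Sum>i\<in>C k (sel A). rademacher A i)"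
      unfolding eq .
    show ?thesis
      unfolding sum.distrib 1 2[symmetric] by (simp add: sum_distrib_left[symmetric] card_Pow)
  qed
  also have "(\<Sum>i<N. \<Sum>A\<in>Pow {..<N}. rademacher A i) = 0"
    using sum_rademacher_sets by (intro sum.neutral) auto
  also have "(- B) * 0 + \<delta> * (\<Sum>k<K. \<Sum>A\<in>Pow {..<N}. \<Sum>i\<in>C k (sel A). rademacher A i) + 2 ^ N * real N * \<delta>
     \<le> (- B) * 0 + \<delta> * (\<Sum>k<K. 2 ^ N * (c / l + real N * l)) + 2 ^ N * real N * \<delta>"
    using level \<delta> by (intro add_mono mult_left_mono sum_mono order_refl) auto
  \<comment> \<open>Each level costs
    \<open>c / l + N * l = 2 * N / K + 2 * K * ln K * \<nu>\<close>, the levels together have weight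
    \<open>\<delta> * K = 2 * B\<close>, and the discretization error supplies the third
    \<open>N / K\<close>.\<close>
  also have "\<dots> = 2 ^ N * vc_rademacher_bound B K \<nu> N"
    using K by (simp add: vc_rademacher_bound_def c_def \<delta>_def l_def field_simps power2_eq_square)
  finally show ?thesis .
qed

section \<open>Hoeffding's representation of a U-statistic\<close>

lemma card_off_diagonal:
  "real (card {(i, j). i < n \<and> j < n \<and> i \<noteq> j}) = real n * (real n - 1)"
proof -
  have "{(i, j). i < n \<and> j < n \<and> i \<noteq> j} = {..<n} \<times> {..<n} - (\<lambda>i. (i, i)) ` {..<n}" by auto
  moreover have "card ({..<n} \<times> {..<n} - (\<lambda>i. (i, i)) ` {..<n}) = n * n - n"
    by (subst card_Diff_subset) (auto simp: card_image inj_on_def)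
  moreover have "real (n * n - n) = real n * (real n - 1)"
    by (cases n) (simp_all add: of_nat_diff algebra_simps)
  ultimately show ?thesis by (simp only:)
qed

text \<open>Double counting: every permutation merely rearranges the off-diagonal pairs, and the sum
  over all permutations is the same number \<open>T\<close> at every off-diagonal pair.\<close>

lemma U_stat_eq_average_permutations:
  fixes h :: "'z \<Rightarrow> 'z \<Rightarrow> 't \<Rightarrow> real"
  assumes n: "n \<ge> 2" and ab: "\<And>i. i < N \<Longrightarrow> a i < n \<and> b i < n \<and> a i \<noteq> b i"
  shows "real N * U_stat n h z \<theta> =
    (\<Sum>\<pi> | \<pi> permutes {..<n}. \<Sum>i<N. h (z (\<pi> (a i))) (z (\<pi> (b i))) \<theta>) / fact n"
proof -
  let ?S = "{\<pi>. \<pi> permutes {..<n}}"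
  let ?D = "{(i, j). i < n \<and> j < n \<and> i \<noteq> j}"
  define H where "H \<pi> i j = h (z (\<pi> i)) (z (\<pi> j)) \<theta>" for \<pi> :: "nat \<Rightarrow> nat" and i j
  define T where "T = (\<Sum>\<pi>\<in>?S. H \<pi> 0 1)"
  have T: "(\<Sum>\<pi>\<in>?S. H \<pi> i j) = T" if "i < n" "j < n" "i \<noteq> j" for i j
  proof -
    \<comment> \<open>The right transposition sends 0 to \<open>i\<close>. The left one then moves
      the image of 1 to \<open>j\<close> and fixes \<open>i\<close>, as neither of its two points is
      \<open>i\<close>.\<close>
    let ?\<rho> = "Transposition.transpose (Transposition.transpose 0 i 1) j \<circ> Transposition.transpose 0 i"
    have ne: "Transposition.transpose 0 i 1 \<noteq> i" by (auto simp: Transposition.transpose_def)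
    have p: "?\<rho> permutes {..<n}"
      using that n by (intro permutes_compose permutes_swap_id) (auto simp: Transposition.transpose_def)
    have "?\<rho> 0 = i" "?\<rho> 1 = j" using that ne by (auto simp: Transposition.transpose_def)
    then show ?thesis
      unfolding T_def by (subst (2) sum_permutations_compose_right[OF p]) (simp add: H_def)
  qed
  have tot: "(\<Sum>(i, j)\<in>?D. H \<pi> i j) = (\<Sum>(i, j)\<in>?D. h (z i) (z j) \<theta>)" if "\<pi> permutes {..<n}" for \<pi>
    unfolding H_def
    by (rule sum.reindex_bij_witness[where i = "\<lambda>(i, j). (inv \<pi> i, inv \<pi> j)" and j = "\<lambda>(i, j). (\<pi> i, \<pi> j)"])
      (use permutes_in_image[OF that] permutes_in_image[OF permutes_inv[OF that]] permutes_inverses[OF that]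
        permutes_inj[OF that] permutes_inj[OF permutes_inv[OF that]] in \<open>auto simp: inj_eq\<close>)
  have "real n * (real n - 1) * T = (\<Sum>q\<in>?D. T)"
    unfolding sum_constant card_off_diagonal ..
  also have "\<dots> = (\<Sum>(i, j)\<in>?D. T)"
    by (rule sum.cong) auto
  also have "\<dots> = (\<Sum>(i, j)\<in>?D. \<Sum>\<pi>\<in>?S. H \<pi> i j)"
    using T by (intro sum.cong) auto
  also have "\<dots> = (\<Sum>\<pi>\<in>?S. \<Sum>(i, j)\<in>?D. H \<pi> i j)"
    unfolding case_prod_unfold by (rule sum.swap)
  also have "\<dots> = (\<Sum>\<pi>\<in>?S. \<Sum>(i, j)\<in>?D. h (z i) (z j) \<theta>)"
    by (rule sum.cong[OF refl], rule tot) simp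
  also have "\<dots> = fact n * (\<Sum>(i, j)\<in>?D. h (z i) (z j) \<theta>)"
    by (simp add: card_permutations[OF refl])
  finally have "U_stat n h z \<theta> = T / fact n"
    using n unfolding U_stat_def by (simp add: field_simps)
  moreover have "(\<Sum>\<pi>\<in>?S. \<Sum>i<N. H \<pi> (a i) (b i)) = real N * T"
    using T ab by (subst sum.swap) simp
  ultimately show ?thesis unfolding H_def by simp
qed

section \<open>U-processes at a measurable selection\<close>

lemma distr_PiM_pair:
  assumes "prob_space P" "finite I" "i \<in> I" "j \<in> I" "i \<noteq> j"
  shows "distr (PiM I (\<lambda>_. P)) (P \<Otimes>\<^sub>M P) (\<lambda>z. (z i, z j)) = P \<Otimes>\<^sub>M P"
proof -
  interpret P: prob_space P by fact
  show ?thesis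
  proof (rule pair_measure_eqI[symmetric])
    fix A B assume AB: "A \<in> sets P" "B \<in> sets P"
    let ?E = "\<lambda>k. if k = i then A else B"
    have E: "(\<lambda>z. (z i, z j)) -` (A \<times> B) \<inter> space (PiM I (\<lambda>_. P)) = prod_emb I (\<lambda>_. P) {i, j} (\<Pi>\<^sub>E k\<in>{i, j}. ?E k)"
      using assms AB[THEN sets.sets_into_space]
      by (auto simp: prod_emb_def space_PiM PiE_iff split: if_splits)
    have "emeasure (distr (PiM I (\<lambda>_. P)) (P \<Otimes>\<^sub>M P) (\<lambda>z. (z i, z j))) (A \<times> B) =
        emeasure (PiM I (\<lambda>_. P)) (prod_emb I (\<lambda>_. P) {i, j} (\<Pi>\<^sub>E k\<in>{i, j}. ?E k))"
      using assms AB by (subst emeasure_distr) (auto simp: E intro!: measurable_Pair measurable_component_singleton)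
    also have "\<dots> = (\<Prod>k\<in>{i, j}. emeasure P (?E k))"
      using assms AB by (intro emeasure_PiM_emb) auto
    also have "\<dots> = emeasure P A * emeasure P B" using assms(5) by simp
    finally show "emeasure P A * emeasure P B = emeasure (distr (PiM I (\<lambda>_. P)) (P \<Otimes>\<^sub>M P) (\<lambda>z. (z i, z j))) (A \<times> B)" ..
  qed (auto simp: P.sigma_finite_measure_axioms)
qed

text \<open>Exchanges the sample with indices \<open>{..<n}\<close> and its ghost copy with indices \<open>{n..<2 * n}\<close> on \<open>S\<close>.\<close>

definition ghost_swap :: "nat \<Rightarrow> nat set \<Rightarrow> nat \<Rightarrow> nat" where
  "ghost_swap n S k = (if k < n \<and> k \<in> S then k + n else if n \<le> k \<and> k - n \<in> S then k - n else k)"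

lemma ghost_swap_involution:
  assumes "S \<subseteq> {..<n}"
  shows "ghost_swap n S (ghost_swap n S k) = k"
  using assms by (auto simp: ghost_swap_def)

lemma ghost_swap_lt:
  assumes "S \<subseteq> {..<n}" "k < 2 * n"
  shows "ghost_swap n S k < 2 * n"
  using assms by (auto simp: ghost_swap_def)

lemma distr_PiM_ghost_swap:
  assumes "prob_space P" "S \<subseteq> {..<n}"
  shows "distr (PiM {..<2 * n} (\<lambda>_. P)) (PiM {..<2 * n} (\<lambda>_. P)) (\<lambda>w. \<lambda>k\<in>{..<2 * n}. w (ghost_swap n S k))
    = PiM {..<2 * n} (\<lambda>_. P)"
proof (rule distr_PiM_reindex)
  show "inj_on (ghost_swap n S) {..<2 * n}"
    by (rule inj_on_inverseI[where g = "ghost_swap n S"]) (rule ghost_swap_involution[OF assms(2)])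
qed (use assms ghost_swap_lt in auto)

text \<open>Joint measurability allows a data-dependent parameter to be substituted into the kernel.
  In the application \<open>L\<close> is \<open>rvec_borel p\<close> restricted to
  \<open>\<Theta>\<close>.\<close>

locale bounded_kernel = prob_space P for P :: "'z measure" +
  fixes L :: "'t measure" and h :: "'z \<Rightarrow> 'z \<Rightarrow> 't \<Rightarrow> real" and B :: real
  assumes kernel_measurable: "(\<lambda>((x, y), \<theta>). h x y \<theta>) \<in> borel_measurable ((P \<Otimes>\<^sub>M P) \<Otimes>\<^sub>M L)"
    and kernel_bounded: "\<And>x y \<theta>. x \<in> space P \<Longrightarrow> y \<in> space P \<Longrightarrow> \<theta> \<in> space L \<Longrightarrow> \<bar>h x y \<theta>\<bar> \<le> B"
begin

abbreviation prod_P :: "nat set \<Rightarrow> (nat \<Rightarrow> 'z) measure" where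
  "prod_P I \<equiv> PiM I (\<lambda>_. P)"

text \<open>This is the mean criterion, by \<open>integral_U_stat\<close>. At a random parameter
  \<open>T z\<close> it is evaluated with the parameter frozen, so its integral generally differs
  from that of the sample criterion at \<open>T z\<close>; this difference is what has to be
  bounded.\<close>

definition kernel_mean :: "'t \<Rightarrow> real" where
  "kernel_mean \<theta> = (\<integral>(x, y). h x y \<theta> \<partial>(P \<Otimes>\<^sub>M P))"

lemma prob_space_prod_P: "prob_space (prod_P I)"
  by (rule prob_space_PiM) (rule prob_space_axioms)

lemma measurable_kernel [measurable (raw)]:
  assumes [measurable]: "X \<in> measurable N P" "Y \<in> measurable N P" "T \<in> measurable N L"
  shows "(\<lambda>w. h (X w) (Y w) (T w)) \<in> borel_measurable N"
proof -
  have "(\<lambda>w. ((X w, Y w), T w)) \<in> measurable N ((P \<Otimes>\<^sub>M P) \<Otimes>\<^sub>M L)" by measurable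
  from measurable_compose[OF this kernel_measurable] show ?thesis by simp
qed

lemma borel_measurable_kernel_mean [measurable]: "kernel_mean \<in> borel_measurable L"
proof -
  interpret PP: prob_space "P \<Otimes>\<^sub>M P" by (rule prob_space_pair[OF prob_space_axioms prob_space_axioms])
  have "(\<lambda>(\<theta>, q). h (fst q) (snd q) \<theta>) \<in> borel_measurable (L \<Otimes>\<^sub>M (P \<Otimes>\<^sub>M P))"
    by measurable
  from PP.borel_measurable_lebesgue_integral[OF this] show ?thesis
    unfolding kernel_mean_def case_prod_unfold by simp
qed

lemma kernel_mean_bounded:
  assumes "\<theta> \<in> space L" shows "\<bar>kernel_mean \<theta>\<bar> \<le> B"
proof -
  interpret PP: prob_space "P \<Otimes>\<^sub>M P" by (rule prob_space_pair[OF prob_space_axioms prob_space_axioms])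
  have bound: "norm (h (fst q) (snd q) \<theta>) \<le> B" if "q \<in> space (P \<Otimes>\<^sub>M P)" for q
    using that assms unfolding real_norm_def space_pair_measure mem_Times_iff
    by (elim conjE) (rule kernel_bounded)
  have [measurable]: "(\<lambda>q. h (fst q) (snd q) \<theta>) \<in> borel_measurable (P \<Otimes>\<^sub>M P)"
    using assms by measurable
  have int: "integrable (P \<Otimes>\<^sub>M P) (\<lambda>q. h (fst q) (snd q) \<theta>)"
    by (rule PP.integrable_const_bound[of _ B], rule AE_I2, erule bound) measurable
  have "norm (\<integral>q. h (fst q) (snd q) \<theta> \<partial>(P \<Otimes>\<^sub>M P)) \<le> (\<integral>q. norm (h (fst q) (snd q) \<theta>) \<partial>(P \<Otimes>\<^sub>M P))"
    by (rule integral_norm_bound)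
  also have "\<dots> \<le> (\<integral>q. B \<partial>(P \<Otimes>\<^sub>M P))"
    by (rule integral_mono[OF integrable_norm[OF int] PP.integrable_const bound])
  finally have "norm (\<integral>q. h (fst q) (snd q) \<theta> \<partial>(P \<Otimes>\<^sub>M P)) \<le> (\<integral>q. B \<partial>(P \<Otimes>\<^sub>M P))" .
  then show ?thesis unfolding kernel_mean_def case_prod_unfold by (simp add: PP.prob_space)
qed

lemma integrable_kernel:
  assumes N: "prob_space N" and [measurable]: "X \<in> measurable N P" "Y \<in> measurable N P" "T \<in> measurable N L"
  shows "integrable N (\<lambda>w. h (X w) (Y w) (T w))"
proof -
  interpret N: prob_space N by fact
  show ?thesis
    by (rule N.integrable_const_bound[of _ B])
      (auto intro!: kernel_bounded AE_I2 simp: measurable_space[OF assms(2)] measurable_space[OF assms(3)] measurable_space[OF assms(4)])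
qed

lemma integrable_kernel_mean:
  assumes N: "prob_space N" and [measurable]: "T \<in> measurable N L"
  shows "integrable N (\<lambda>w. kernel_mean (T w))"
proof -
  interpret N: prob_space N by fact
  show ?thesis
    by (rule N.integrable_const_bound[of _ B])
      (auto intro!: kernel_mean_bounded AE_I2 simp: measurable_space[OF assms(2)])
qed

lemma integral_kernel_pair:
  assumes "finite I" "i \<in> I" "j \<in> I" "i \<noteq> j" "\<theta> \<in> space L"
  shows "(\<integral>z. h (z i) (z j) \<theta> \<partial>prod_P I) = kernel_mean \<theta>"
proof -
  have [measurable]: "(\<lambda>q. h (fst q) (snd q) \<theta>) \<in> borel_measurable (P \<Otimes>\<^sub>M P)"
    using assms(5) by measurable
  have "kernel_mean \<theta> = (\<integral>q. h (fst q) (snd q) \<theta> \<partial>distr (prod_P I) (P \<Otimes>\<^sub>M P) (\<lambda>z. (z i, z j)))"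
    unfolding distr_PiM_pair[OF prob_space_axioms assms(1-4)] kernel_mean_def case_prod_unfold ..
  also have "\<dots> = (\<integral>z. h (z i) (z j) \<theta> \<partial>prod_P I)"
    using assms by (subst integral_distr) (auto intro!: measurable_Pair measurable_component_singleton)
  finally show ?thesis ..
qed

text \<open>Fubini: once the coordinates in \<open>I\<close> are frozen, the parameter is constant
  and the coordinates \<open>i\<close> and \<open>j\<close> form a fresh pair.\<close>

lemma integral_kernel_selection_ghost:
  assumes IJ: "finite I" "finite J" "I \<inter> J = {}" "i \<in> J" "j \<in> J" "i \<noteq> j"
    and T [measurable]: "T \<in> measurable (prod_P I) L"
  shows "(\<integral>w. h (w i) (w j) (T (restrict w I)) \<partial>prod_P (I \<union> J)) = (\<integral>z. kernel_mean (T z) \<partial>prod_P I)"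
proof -
  interpret product_sigma_finite "\<lambda>_. P" ..
  have [measurable]: "(\<lambda>w. restrict w I) \<in> measurable (prod_P (I \<union> J)) (prod_P I)"
    by (rule measurable_restrict_subset) auto
  have int: "integrable (prod_P (I \<union> J)) (\<lambda>w. h (w i) (w j) (T (restrict w I)))"
    using IJ by (intro integrable_kernel prob_space_prod_P) (auto intro: measurable_component_singleton)
  have "(\<integral>w. h (w i) (w j) (T (restrict w I)) \<partial>prod_P (I \<union> J)) =
     (\<integral>x. (\<integral>y. h (merge I J (x, y) i) (merge I J (x, y) j) (T (restrict (merge I J (x, y)) I)) \<partial>prod_P J) \<partial>prod_P I)"
    by (rule product_integral_fold[OF IJ(3,1,2) int])
  also have "\<dots> = (\<integral>x. kernel_mean (T x) \<partial>prod_P I)"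
  proof (rule Bochner_Integration.integral_cong[OF refl])
    fix x assume x: "x \<in> space (prod_P I)"
    have r: "restrict (merge I J (x, y)) I = x" for y
      using x by (auto simp: restrict_def merge_def space_PiM PiE_iff extensional_def)
    have "i \<notin> I" "j \<notin> I" using IJ by auto
    then show "(\<integral>y. h (merge I J (x, y) i) (merge I J (x, y) j) (T (restrict (merge I J (x, y)) I)) \<partial>prod_P J) = kernel_mean (T x)"
      unfolding r using IJ measurable_space[OF T x] by (simp add: merge_def integral_kernel_pair)
  qed
  finally show ?thesis .
qed

lemma integral_kernel_selection_restrict:
  assumes IJ: "I \<subseteq> J" "finite J" "i \<in> I" "j \<in> I"
    and T [measurable]: "T \<in> measurable (prod_P I) L"
  shows "(\<integral>w. h (w i) (w j) (T (restrict w I)) \<partial>prod_P J) = (\<integral>z. h (z i) (z j) (T z) \<partial>prod_P I)"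
proof -
  have *: "prod_P I = distr (prod_P J) (prod_P I) (\<lambda>w. restrict w I)"
    using distr_PiM_reindex[of J "\<lambda>_. P" id I] prob_space_axioms IJ(1) by (simp add: Pi_def subset_iff)
  have [measurable]: "(\<lambda>w. restrict w I) \<in> measurable (prod_P J) (prod_P I)"
    using IJ by (intro measurable_restrict_subset)
  have [measurable]: "(\<lambda>z. h (z i) (z j) (T z)) \<in> borel_measurable (prod_P I)"
    using IJ by (intro measurable_kernel measurable_component_singleton T)
  have "(\<integral>z. h (z i) (z j) (T z) \<partial>prod_P I) = (\<integral>z. h (z i) (z j) (T z) \<partial>distr (prod_P J) (prod_P I) (\<lambda>w. restrict w I))"
    using * by simp
  also have "\<dots> = (\<integral>w. h (w i) (w j) (T (restrict w I)) \<partial>prod_P J)"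
    using IJ by (subst integral_distr) auto
  finally show ?thesis ..
qed

lemma borel_measurable_U_stat [measurable]:
  assumes T: "T \<in> measurable (prod_P {..<n}) L"
  shows "(\<lambda>z. U_stat n h z (T z)) \<in> borel_measurable (prod_P {..<n})"
  unfolding U_stat_def case_prod_unfold
  by (intro borel_measurable_divide borel_measurable_sum borel_measurable_const
      measurable_kernel measurable_component_singleton T) auto

lemma integral_U_stat:
  assumes n: "n \<ge> 2" and \<theta>: "\<theta> \<in> space L"
  shows "(\<integral>z. U_stat n h z \<theta> \<partial>prod_P {..<n}) = kernel_mean \<theta>"
proof -
  define D where "D = {(i, j). i < n \<and> j < n \<and> i \<noteq> j}"
  have D: "fst q \<in> {..<n}" "snd q \<in> {..<n}" "fst q \<noteq> snd q" if "q \<in> D" for q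
    using that by (auto simp: D_def)
  have int: "integrable (prod_P {..<n}) (\<lambda>z. h (z (fst q)) (z (snd q)) \<theta>)" if "q \<in> D" for q
    using D[OF that] \<theta> by (intro integrable_kernel prob_space_prod_P measurable_component_singleton measurable_const) auto
  have "(\<integral>z. U_stat n h z \<theta> \<partial>prod_P {..<n})
      = (\<Sum>q\<in>D. \<integral>z. h (z (fst q)) (z (snd q)) \<theta> \<partial>prod_P {..<n}) / (real n * (real n - 1))"
    unfolding U_stat_def D_def[symmetric] unfolding case_prod_unfold integral_divide_zero
    by (subst Bochner_Integration.integral_sum) (use int in auto)
  also have "(\<Sum>q\<in>D. \<integral>z. h (z (fst q)) (z (snd q)) \<theta> \<partial>prod_P {..<n}) = (\<Sum>q\<in>D. kernel_mean \<theta>)"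
    using \<theta> D by (intro sum.cong refl integral_kernel_pair) auto
  also have "\<dots> = real n * (real n - 1) * kernel_mean \<theta>"
    unfolding D_def by (simp add: card_off_diagonal)
  finally show ?thesis using n by simp
qed

text \<open>Symmetrization: averaging over all swaps with the ghost sample bounds the expectation by a
  Rademacher sum, pointwise in the doubled sample, so no measurability of a supremum over the
  parameter is needed.\<close>

lemma symmetrized_selection_bound:
  assumes vc: "vc_subgraph_class (space P \<times> space P) ((\<lambda>\<theta> (x, y). h x y \<theta>) ` space L) \<nu>"
    and B: "0 < B" and K: "K \<ge> 1" and n: "2 * N \<le> n" and \<pi>: "\<pi> permutes {..<n}"
    and T [measurable]: "T \<in> measurable (prod_P {..<n}) L"
  shows "(\<integral>z. (\<Sum>i<N. h (z (\<pi> (2 * i))) (z (\<pi> (2 * i + 1))) (T z)) \<partial>prod_P {..<n})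
      - real N * (\<integral>z. kernel_mean (T z) \<partial>prod_P {..<n})
    \<le> 2 * vc_rademacher_bound B K \<nu> N"
proof -
  define a where "a i = \<pi> (2 * i)" for i
  define b where "b i = \<pi> (2 * i + 1)" for i
  \<comment> \<open>Both coordinates of a pair are exchanged together, so pair \<open>i\<close>
    becomes its ghost pair exactly when \<open>i \<in> A\<close>. Coordinates outside the
    \<open>N\<close> pairs stay in place, although \<open>T\<close> may depend on them.\<close>
  define blk where "blk A = a ` A \<union> b ` A" for A
  let ?R = "prod_P {..<2 * n}"
  define sw where "sw A w = (\<lambda>k\<in>{..<2 * n}. w (ghost_swap n (blk A) k))" for A and w :: "nat \<Rightarrow> 'z"
  define T' where "T' w = T (restrict w {..<n})" for w
  define D where "D w = (\<Sum>i<N. h (w (a i)) (w (b i)) (T' w) - h (w (n + a i)) (w (n + b i)) (T' w))" for w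
  interpret R: prob_space ?R by (rule prob_space_prod_P)
  have \<pi>_inj: "\<pi> i = \<pi> j \<longleftrightarrow> i = j" for i j
    using permutes_inj[OF \<pi>] by (simp add: inj_eq)
  have \<pi>_lt: "\<pi> i < n" if "i < n" for i using permutes_in_image[OF \<pi>, of i] that by simp
  have ab_lt: "a i < n" "b i < n" if "i < N" for i
    using that n by (auto simp: a_def b_def intro!: \<pi>_lt)
  have ab_ne: "a i \<noteq> b j" "b i \<noteq> a j" for i j
    unfolding a_def b_def \<pi>_inj by presburger+
  have a_inj: "a i = a j \<longleftrightarrow> i = j" and b_inj: "b i = b j \<longleftrightarrow> i = j" for i j
    unfolding a_def b_def \<pi>_inj by auto
  have blk_a: "a i \<in> blk A \<longleftrightarrow> i \<in> A" and blk_b: "b i \<in> blk A \<longleftrightarrow> i \<in> A" for i A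
    unfolding blk_def by (simp_all add: image_iff a_inj b_inj ab_ne)
  have blk_sub: "blk A \<subseteq> {..<n}" if "A \<subseteq> {..<N}" for A
    using that by (auto simp: blk_def intro!: ab_lt)
  have meas_restrict [measurable]: "(\<lambda>w. restrict w {..<n}) \<in> measurable ?R (prod_P {..<n})"
    by (rule measurable_restrict_subset) auto
  have T'_meas [measurable]: "T' \<in> measurable ?R L"
    unfolding T'_def by measurable
  have comp [measurable]: "(\<lambda>w. w k) \<in> measurable ?R P" if "k < 2 * n" for k
    using that by (intro measurable_component_singleton) auto
  have lt2: "a i < 2 * n" "b i < 2 * n" "n + a i < 2 * n" "n + b i < 2 * n" if "i < N" for i
    using ab_lt[OF that] by auto
  have int1: "integrable ?R (\<lambda>w. h (w (a i)) (w (b i)) (T' w))" if "i < N" for i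
    using lt2[OF that] by (intro integrable_kernel R.prob_space_axioms comp T'_meas)
  have int2: "integrable ?R (\<lambda>w. h (w (n + a i)) (w (n + b i)) (T' w))" if "i < N" for i
    using lt2[OF that] by (intro integrable_kernel R.prob_space_axioms comp T'_meas)
  have intD: "integrable ?R D"
    unfolding D_def using int1 int2 by (intro Bochner_Integration.integrable_sum Bochner_Integration.integrable_diff) auto
  have D_eq: "(\<integral>w. D w \<partial>?R) = (\<integral>z. (\<Sum>i<N. h (z (\<pi> (2 * i))) (z (\<pi> (2 * i + 1))) (T z)) \<partial>prod_P {..<n})
      - real N * (\<integral>z. kernel_mean (T z) \<partial>prod_P {..<n})"
  proof -
    have sample: "(\<integral>w. h (w (a i)) (w (b i)) (T' w) \<partial>?R) = (\<integral>z. h (z (a i)) (z (b i)) (T z) \<partial>prod_P {..<n})"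
      if "i < N" for i
      unfolding T'_def using ab_lt[OF that] by (intro integral_kernel_selection_restrict T) auto
    have un: "{..<n} \<union> {n..<2 * n} = {..<2 * n}" by auto
    have ghost: "(\<integral>w. h (w (n + a i)) (w (n + b i)) (T' w) \<partial>?R) = (\<integral>z. kernel_mean (T z) \<partial>prod_P {..<n})"
      if "i < N" for i
      unfolding T'_def un[symmetric] using ab_lt[OF that] ab_ne(1)
      by (intro integral_kernel_selection_ghost T) auto
    have int3: "integrable (prod_P {..<n}) (\<lambda>z. h (z (a i)) (z (b i)) (T z))" if "i < N" for i
      using ab_lt[OF that] by (intro integrable_kernel prob_space_prod_P measurable_component_singleton T) auto
    have "(\<integral>w. D w \<partial>?R) = (\<Sum>i<N. (\<integral>w. h (w (a i)) (w (b i)) (T' w) \<partial>?R) - (\<integral>w. h (w (n + a i)) (w (n + b i)) (T' w) \<partial>?R))"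
      unfolding D_def using int1 int2 by (simp add: Bochner_Integration.integral_sum)
    also have "\<dots> = (\<Sum>i<N. (\<integral>z. h (z (a i)) (z (b i)) (T z) \<partial>prod_P {..<n}) - (\<integral>z. kernel_mean (T z) \<partial>prod_P {..<n}))"
      using sample ghost by (intro sum.cong) auto
    also have "\<dots> = (\<integral>z. (\<Sum>i<N. h (z (a i)) (z (b i)) (T z)) \<partial>prod_P {..<n}) - real N * (\<integral>z. kernel_mean (T z) \<partial>prod_P {..<n})"
      using int3 by (simp add: sum_subtractf Bochner_Integration.integral_sum)
    finally show ?thesis unfolding a_def b_def .
  qed
  have swap: "sw A \<in> measurable ?R ?R" "(\<integral>w. D (sw A w) \<partial>?R) = (\<integral>w. D w \<partial>?R)" if "A \<subseteq> {..<N}" for A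
  proof -
    show meas: "sw A \<in> measurable ?R ?R"
      unfolding sw_def using ghost_swap_lt[OF blk_sub[OF that]]
      by (intro measurable_restrict comp) auto
    have "(\<integral>w. D w \<partial>?R) = (\<integral>w. D w \<partial>distr ?R ?R (sw A))"
      using distr_PiM_ghost_swap[OF prob_space_axioms blk_sub[OF that]] unfolding sw_def by simp
    also have "\<dots> = (\<integral>w. D (sw A w) \<partial>?R)"
      by (rule integral_distr[OF meas]) (use intD in auto)
    finally show "(\<integral>w. D (sw A w) \<partial>?R) = (\<integral>w. D w \<partial>?R)" ..
  qed
  have intDsw: "integrable ?R (\<lambda>w. D (sw A w))" if "A \<subseteq> {..<N}" for A
  proof (rule integrable_distr[OF swap(1)[OF that]])
    show "integrable (distr ?R ?R (sw A)) D"
      using intD distr_PiM_ghost_swap[OF prob_space_axioms blk_sub[OF that]] unfolding sw_def by simp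
  qed
  \<comment> \<open>The exchange flips the \<open>i\<close>-th difference for
    \<open>i \<in> A\<close>, at the price of a parameter \<open>T' (sw A w)\<close> that varies
    with \<open>A\<close>. For fixed \<open>w\<close> it is a selection driven by the signs.\<close>
  have D_sw: "D (sw A w) = (\<Sum>i<N. rademacher A i * h (w (a i)) (w (b i)) (T' (sw A w)))
       - (\<Sum>i<N. rademacher A i * h (w (n + a i)) (w (n + b i)) (T' (sw A w)))"
    if "A \<subseteq> {..<N}" for A w
    unfolding D_def sum_subtractf[symmetric]
  proof (rule sum.cong[OF refl])
    fix i assume "i \<in> {..<N}"
    then have i: "i < N" by simp
    show "h (sw A w (a i)) (sw A w (b i)) (T' (sw A w)) - h (sw A w (n + a i)) (sw A w (n + b i)) (T' (sw A w)) =
       rademacher A i * h (w (a i)) (w (b i)) (T' (sw A w)) - rademacher A i * h (w (n + a i)) (w (n + b i)) (T' (sw A w))"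
      using ab_lt[OF i] by (cases "i \<in> A") (simp_all add: sw_def ghost_swap_def blk_a blk_b rademacher_def add.commute)
  qed
  have pointwise: "(\<Sum>A\<in>Pow {..<N}. D (sw A w)) \<le> 2 ^ N * (2 * vc_rademacher_bound B K \<nu> N)"
    if w: "w \<in> space ?R" for w
  proof -
    have wP: "w k \<in> space P" if "k < 2 * n" for k
      using w that by (auto simp: space_PiM PiE_iff)
    have T'_sp: "T' (sw A w) \<in> space L" if "A \<subseteq> {..<N}" for A
      using measurable_space[OF T'_meas measurable_space[OF swap(1)[OF that] w]] .
    define g where "g A = (\<lambda>(x, y). h x y (T' (sw A w)))" for A
    have g: "g A \<in> (\<lambda>\<theta> (x, y). h x y \<theta>) ` space L" if "A \<subseteq> {..<N}" for A
      unfolding g_def using T'_sp[OF that] by (rule imageI)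
    have bd: "\<bar>f x\<bar> \<le> B" if "f \<in> (\<lambda>\<theta> (x, y). h x y \<theta>) ` space L" "x \<in> space P \<times> space P" for f x
      using that by (elim imageE SigmaE) (simp add: kernel_bounded)
    have u: "(\<lambda>i. (w (a i), w (b i))) \<in> {..<N} \<rightarrow> space P \<times> space P"
      "(\<lambda>i. (w (n + a i), w (n + b i))) \<in> {..<N} \<rightarrow> space P \<times> space P"
      by (auto intro!: wP lt2)
    have 1: "(\<Sum>A\<in>Pow {..<N}. \<Sum>i<N. rademacher A i * g A (w (a i), w (b i))) \<le> 2 ^ N * vc_rademacher_bound B K \<nu> N"
      by (rule rademacher_complexity_vc_subgraph[where sel = g, OF vc u(1) B _ K], erule (1) bd, erule g)
    \<comment> \<open>The ghost sum enters with a minus sign. Complementing the sign set absorbs it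
      if the selection is complemented too. The two sums account for the factor 2 in the
      bound.\<close>
    have 2: "(\<Sum>A\<in>Pow {..<N}. \<Sum>i<N. rademacher A i * g ({..<N} - A) (w (n + a i), w (n + b i))) \<le> 2 ^ N * vc_rademacher_bound B K \<nu> N"
      by (rule rademacher_complexity_vc_subgraph[where sel = "\<lambda>A. g ({..<N} - A)", OF vc u(2) B _ K],
          erule (1) bd, rule g, rule Diff_subset)
    have 3: "(\<Sum>A\<in>Pow {..<N}. - (\<Sum>i<N. rademacher A i * g A (w (n + a i), w (n + b i)))) =
       (\<Sum>A\<in>Pow {..<N}. \<Sum>i<N. rademacher A i * g ({..<N} - A) (w (n + a i), w (n + b i)))"
    proof (rule sum.reindex_bij_witness[where i = "\<lambda>A. {..<N} - A" and j = "\<lambda>A. {..<N} - A"])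
      fix A assume A: "A \<in> Pow {..<N}"
      then have AA: "{..<N} - ({..<N} - A) = A" by auto
      show "(\<Sum>i<N. rademacher ({..<N} - A) i * g ({..<N} - ({..<N} - A)) (w (n + a i), w (n + b i))) =
          - (\<Sum>i<N. rademacher A i * g A (w (n + a i), w (n + b i)))"
        unfolding AA sum_negf[symmetric] by (rule sum.cong) (auto simp: rademacher_def)
    qed auto
    have 4: "(\<Sum>A\<in>Pow {..<N}. D (sw A w)) = (\<Sum>A\<in>Pow {..<N}. \<Sum>i<N. rademacher A i * g A (w (a i), w (b i)))
       + (\<Sum>A\<in>Pow {..<N}. - (\<Sum>i<N. rademacher A i * g A (w (n + a i), w (n + b i))))"
      by (subst sum.distrib[symmetric], rule sum.cong[OF refl]) (simp add: D_sw g_def)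
    have "2 ^ N * vc_rademacher_bound B K \<nu> N + 2 ^ N * vc_rademacher_bound B K \<nu> N
        = 2 ^ N * (2 * vc_rademacher_bound B K \<nu> N)"
      by simp
    then show ?thesis using add_mono[OF 1 2] unfolding 4 3 by (simp only:)
  qed
  have "2 ^ N * (\<integral>w. D w \<partial>?R) = (\<Sum>A\<in>Pow {..<N}. \<integral>w. D (sw A w) \<partial>?R)"
    using swap(2) by (simp add: card_Pow)
  also have "\<dots> = (\<integral>w. (\<Sum>A\<in>Pow {..<N}. D (sw A w)) \<partial>?R)"
    using intDsw by (intro Bochner_Integration.integral_sum[symmetric]) auto
  also have "\<dots> \<le> (\<integral>w. 2 ^ N * (2 * vc_rademacher_bound B K \<nu> N) \<partial>?R)"
    using pointwise intDsw by (intro integral_mono Bochner_Integration.integrable_sum) auto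
  also have "\<dots> = 2 ^ N * (2 * vc_rademacher_bound B K \<nu> N)"
    by (simp add: R.prob_space)
  finally have "(\<integral>w. D w \<partial>?R) \<le> 2 * vc_rademacher_bound B K \<nu> N" by simp
  then show ?thesis unfolding D_eq .
qed

text \<open>Every permutation gives the same bound with the same \<open>T\<close>, so the average
  over permutations inherits it; \<open>n div 2\<close> is the number of disjoint pairs.\<close>

lemma U_process_selection_bound:
  assumes vc: "vc_subgraph_class (space P \<times> space P) ((\<lambda>\<theta> (x, y). h x y \<theta>) ` space L) \<nu>"
    and B: "0 < B" and K: "K \<ge> 1" and n: "n \<ge> 2"
    and T [measurable]: "T \<in> measurable (prod_P {..<n}) L"
  shows "real (n div 2) * (\<integral>z. U_stat n h z (T z) - kernel_mean (T z) \<partial>prod_P {..<n})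
    \<le> 2 * vc_rademacher_bound B K \<nu> (n div 2)"
proof -
  define N where "N = n div 2"
  let ?Q = "prod_P {..<n}"
  let ?S = "{\<pi>. \<pi> permutes {..<n}}"
  define W where "W \<pi> z = (\<Sum>i<N. h (z (\<pi> (2 * i))) (z (\<pi> (2 * i + 1))) (T z))" for \<pi> z
  have N: "2 * i < n" "2 * i + 1 < n" if "i < N" for i using that by (auto simp: N_def)
  have finS: "finite ?S" by (rule finite_permutations) simp
  have intW: "integrable ?Q (W \<pi>)" if "\<pi> permutes {..<n}" for \<pi>
    unfolding W_def
    using N permutes_in_image[OF that]
    by (intro Bochner_Integration.integrable_sum integrable_kernel prob_space_prod_P measurable_component_singleton T) auto
  have U: "real N * U_stat n h z (T z) = (\<Sum>\<pi>\<in>?S. W \<pi> z) / fact n" for z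
    unfolding W_def using N by (intro U_stat_eq_average_permutations n) auto
  have intU: "integrable ?Q (\<lambda>z. real N * U_stat n h z (T z))"
    unfolding U using intW by (intro integrable_divide_zero Bochner_Integration.integrable_sum) auto
  have intG: "integrable ?Q (\<lambda>z. kernel_mean (T z))"
    by (intro integrable_kernel_mean prob_space_prod_P T)
  have "real N * (\<integral>z. U_stat n h z (T z) - kernel_mean (T z) \<partial>?Q)
      = (\<integral>z. real N * U_stat n h z (T z) - real N * kernel_mean (T z) \<partial>?Q)"
    by (simp add: right_diff_distrib[symmetric])
  also have "\<dots> = (\<integral>z. real N * U_stat n h z (T z) \<partial>?Q) - real N * (\<integral>z. kernel_mean (T z) \<partial>?Q)"
    using intU intG by (subst Bochner_Integration.integral_diff) auto
  also have "(\<integral>z. real N * U_stat n h z (T z) \<partial>?Q) = (\<Sum>\<pi>\<in>?S. \<integral>z. W \<pi> z \<partial>?Q) / fact n"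
    unfolding U using intW by (simp add: Bochner_Integration.integral_sum)
  also have "\<dots> \<le> (\<Sum>\<pi>\<in>?S. 2 * vc_rademacher_bound B K \<nu> N + real N * (\<integral>z. kernel_mean (T z) \<partial>?Q)) / fact n"
  proof (intro divide_right_mono sum_mono)
    fix \<pi> assume "\<pi> \<in> ?S"
    then show "(\<integral>z. W \<pi> z \<partial>?Q) \<le> 2 * vc_rademacher_bound B K \<nu> N + real N * (\<integral>z. kernel_mean (T z) \<partial>?Q)"
      using symmetrized_selection_bound[OF vc B K _ _ T, of N \<pi>] unfolding W_def N_def by auto
  qed simp
  also have "\<dots> = 2 * vc_rademacher_bound B K \<nu> N + real N * (\<integral>z. kernel_mean (T z) \<partial>?Q)"
    by (simp add: card_permutations[OF refl])
  finally show ?thesis unfolding N_def by simp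
qed

end

section \<open>Consistency of the maximizer\<close>

lemma compactin_rvec_top_imp_sets:
  assumes "compactin (rvec_top k) S"
  shows "S \<in> sets (rvec_borel k)"
proof -
  \<comment> \<open>The identity embeds the vectors into all sequences, where compact sets are
    closed and, the index set being countable, the product sigma-algebra is the Borel one.
    Coordinates from \<open>k\<close> on are constantly \<open>undefined\<close>, hence continuous
    and measurable.\<close>
  have "continuous_map (rvec_top k) (product_topology (\<lambda>_. euclideanreal) UNIV) (\<lambda>x. x)"
    unfolding continuous_map_componentwise_UNIV
  proof
    fix i
    show "continuous_map (rvec_top k) euclideanreal (\<lambda>x. x i)"
    proof (cases "i < k")
      case True
      then show ?thesis by (intro continuous_map_product_projection) simp
    next
      case False
      have "continuous_map (rvec_top k) euclideanreal (\<lambda>x. undefined)" by simp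
      then show ?thesis
        by (rule continuous_map_eq) (use False in \<open>auto simp: PiE_iff extensional_def\<close>)
    qed
  qed
  then have "compactin (product_topology (\<lambda>_. euclideanreal) UNIV) ((\<lambda>x. x) ` S)"
    by (rule image_compactin[OF assms])
  then have "compact S" by (simp add: euclidean_product_topology)
  then have "S \<in> sets (PiM UNIV (\<lambda>_. borel))"
    by (subst sets_PiM_equal_borel) (intro borel_closed compact_imp_closed)
  moreover have "(\<lambda>x. x) \<in> measurable (rvec_borel k) (PiM UNIV (\<lambda>_. borel))"
  proof (rule measurable_PiM_single')
    fix i
    show "(\<lambda>x. x i) \<in> measurable (rvec_borel k) borel"
    proof (cases "i < k")
      case True
      then show ?thesis by (intro measurable_component_singleton) simp
    next
      case False
      then have "(\<lambda>x. x i) \<in> measurable (rvec_borel k) borel \<longleftrightarrow> (\<lambda>x. undefined :: real) \<in> measurable (rvec_borel k) borel"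
        by (intro measurable_cong) (auto simp: space_PiM PiE_iff extensional_def)
      then show ?thesis by simp
    qed
  qed (auto simp: space_PiM)
  ultimately have "(\<lambda>x. x) -` S \<inter> space (rvec_borel k) \<in> sets (rvec_borel k)"
    by (rule measurable_sets[rotated])
  moreover have "S \<subseteq> space (rvec_borel k)"
    using compactin_subset_topspace[OF assms] by (simp add: space_PiM)
  ultimately show ?thesis by (simp add: Int_absorb2)
qed

lemma borel_measurable_eucl_dist:
  "(\<lambda>x. eucl_dist k x c) \<in> borel_measurable (rvec_borel k)"
  unfolding eucl_dist_def L2_set_def by measurable

lemma (in prob_space) distr_sample_eq_PiM:
  assumes "n > 0" "indep_vars (\<lambda>_. S) Z {..<n}" "\<And>i. i < n \<Longrightarrow> distr M S (Z i) = P"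
  shows "distr M (PiM {..<n} (\<lambda>_. S)) (sample n Z) = PiM {..<n} (\<lambda>_. P)"
proof -
  have rv: "random_variable S (Z i)" if "i \<in> {..<n}" for i
    using assms(2) that unfolding indep_vars_def by auto
  have "distr M (PiM {..<n} (\<lambda>_. S)) (\<lambda>x. \<lambda>i\<in>{..<n}. Z i x) = PiM {..<n} (\<lambda>i. distr M S (Z i))"
    using assms(1,2) rv indep_vars_iff_distr_eq_PiM'[where I = "{..<n}" and M' = "\<lambda>_. S" and X = Z] by auto
  also have "\<dots> = PiM {..<n} (\<lambda>_. P)"
    using assms(3) by (intro PiM_cong) auto
  finally show ?thesis unfolding sample_def .
qed

lemma U_stat_sample: "U_stat n h (sample n Z \<omega>) \<theta> = U_stat n h (\<lambda>i. Z i \<omega>) \<theta>"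
  unfolding U_stat_def sample_def by (intro arg_cong2[where f = "(/)"] sum.cong) auto

text \<open>The selection that equals the maximizer on the deviation event and the centre \<open>\<theta>0\<close> elsewhere
  has a nonnegative centred criterion, which is at least \<open>\<xi>\<close> on the event.\<close>

lemma argmax_deviation_bound:
  fixes S :: "'z measure" and f :: "'z \<Rightarrow> 'z \<Rightarrow> rvec \<Rightarrow> real"
  assumes M: "prob_space M" and P: "prob_space P" "sets P = sets S" and n: "n \<ge> 2"
    and indep: "prob_space.indep_vars M (\<lambda>_. S) Z {..<n}"
    and ident: "\<And>i. i < n \<Longrightarrow> distr M S (Z i) = P"
    and f_meas: "(\<lambda>((z1, z2), \<theta>). f z1 z2 \<theta>) \<in> borel_measurable ((S \<Otimes>\<^sub>M S) \<Otimes>\<^sub>M restrict_space (rvec_borel p) \<Theta>)"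
    and B: "0 < B" "\<And>\<theta> z1 z2. \<theta> \<in> \<Theta> \<Longrightarrow> z1 \<in> space S \<Longrightarrow> z2 \<in> space S \<Longrightarrow> \<bar>f z1 z2 \<theta>\<bar> \<le> B"
    and vc: "vc_subgraph_class (space S \<times> space S) ((\<lambda>\<theta> (z1, z2). f z1 z2 \<theta>) ` \<Theta>) \<nu>"
    and \<theta>0: "\<theta>0 \<in> \<Theta>" "\<And>z1 z2. z1 \<in> space S \<Longrightarrow> z2 \<in> space S \<Longrightarrow> f z1 z2 \<theta>0 = 0"
    and \<theta>hat_meas: "\<theta>hat \<in> measurable (PiM {..<n} (\<lambda>_. S)) (rvec_borel p)"
    and \<theta>hat: "\<And>\<omega>. \<omega> \<in> space M \<Longrightarrow>
      is_arg_max (U_stat n f (sample n Z \<omega>)) (\<lambda>\<theta>. \<theta> \<in> \<Theta>) (\<theta>hat (sample n Z \<omega>))"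
    and cpt: "compactin (rvec_top p) \<Theta>"
    and sep: "0 < \<xi>" "\<And>\<theta>. \<theta> \<in> \<Theta> \<Longrightarrow> eucl_dist p \<theta> \<theta>0 > \<epsilon> \<Longrightarrow>
      expected_U_stat M n f Z \<theta>0 - expected_U_stat M n f Z \<theta> \<ge> \<xi>"
    and K: "K \<ge> 1"
  shows "real (n div 2) * (\<xi> * measure M {\<omega> \<in> space M. eucl_dist p (\<theta>hat (sample n Z \<omega>)) \<theta>0 > \<epsilon>})
    \<le> 2 * vc_rademacher_bound B K \<nu> (n div 2)"
proof -
  interpret M: prob_space M by fact
  define L where "L = restrict_space (rvec_borel p) \<Theta>"
  have \<Theta>_sub: "\<Theta> \<subseteq> space (rvec_borel p)"
    using compactin_subset_topspace[OF cpt] by (simp add: space_PiM)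
  have \<Theta>_sets: "\<Theta> \<in> sets (rvec_borel p)" by (rule compactin_rvec_top_imp_sets[OF cpt])
  have space_L: "space L = \<Theta>" using \<Theta>_sub by (auto simp: L_def space_restrict_space)
  have space_P: "space P = space S" by (rule sets_eq_imp_space_eq[OF P(2)])
  interpret bounded_kernel P L f B
  proof (intro bounded_kernel.intro bounded_kernel_axioms.intro P(1))
    have "sets ((P \<Otimes>\<^sub>M P) \<Otimes>\<^sub>M L) = sets ((S \<Otimes>\<^sub>M S) \<Otimes>\<^sub>M L)"
      by (intro sets_pair_measure_cong P(2) refl)
    from measurable_cong_sets[OF this refl]
    show "(\<lambda>((x, y), \<theta>). f x y \<theta>) \<in> borel_measurable ((P \<Otimes>\<^sub>M P) \<Otimes>\<^sub>M L)"
      using f_meas unfolding L_def by blast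
  qed (use B(2) space_L space_P in auto)
  let ?Q = "prod_P {..<n}"
  interpret Q: prob_space ?Q by (rule prob_space_prod_P)
  have sets_Q: "sets ?Q = sets (PiM {..<n} (\<lambda>_. S))" by (intro sets_PiM_cong P(2) refl)
  have sample_rv: "sample n Z \<in> measurable M (PiM {..<n} (\<lambda>_. S))"
    unfolding sample_def using indep by (intro measurable_restrict) (auto simp: M.indep_vars_def)
  have sample_meas [measurable]: "sample n Z \<in> measurable M ?Q"
    using sample_rv measurable_cong_sets[OF refl sets_Q] by blast
  have distr_S: "distr M (PiM {..<n} (\<lambda>_. S)) (sample n Z) = ?Q"
    using n by (intro M.distr_sample_eq_PiM indep ident) auto
  have distr_Q: "distr M ?Q (sample n Z) = ?Q"
    using distr_S distr_cong[OF refl sets_Q, of M "sample n Z" "sample n Z"] by simp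
  have \<Gamma>: "expected_U_stat M n f Z \<theta> = kernel_mean \<theta>" if "\<theta> \<in> \<Theta>" for \<theta>
  proof -
    have "(\<lambda>z. U_stat n f z \<theta>) \<in> borel_measurable ?Q"
      using that space_L by (intro borel_measurable_U_stat measurable_const) simp
    then have "(\<integral>z. U_stat n f z \<theta> \<partial>distr M ?Q (sample n Z)) = (\<integral>\<omega>. U_stat n f (sample n Z \<omega>) \<theta> \<partial>M)"
      by (intro integral_distr sample_meas)
    then show ?thesis
      using that space_L n integral_U_stat[of n \<theta>]
      unfolding expected_U_stat_def U_stat_sample distr_Q by simp
  qed
  have z_space: "z i \<in> space S" if "z \<in> space ?Q" "i < n" for z i
    using that by (auto simp: space_PiM PiE_iff space_P)
  have U_\<theta>0: "U_stat n f z \<theta>0 = 0" if "z \<in> space ?Q" for z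
    unfolding U_stat_def using that by (auto intro!: sum.neutral \<theta>0(2) z_space)
  have mean_\<theta>0: "kernel_mean \<theta>0 = 0"
  proof -
    have "kernel_mean \<theta>0 = (\<integral>z. U_stat n f z \<theta>0 \<partial>?Q)"
      using integral_U_stat[OF n] \<theta>0(1) space_L by simp
    also have "\<dots> = (\<integral>z. 0 \<partial>?Q)"
      using U_\<theta>0 by (intro Bochner_Integration.integral_cong) auto
    finally show ?thesis by simp
  qed
  \<comment> \<open>The estimator is known to lie in \<open>\<Theta>\<close> only at samples
    attained by \<open>Z\<close>. The default \<open>\<theta>0\<close> makes
    \<open>\<theta>1\<close> a map into \<open>L\<close> on the whole sample space.\<close>
  define \<theta>1 where "\<theta>1 z = (if \<theta>hat z \<in> \<Theta> then \<theta>hat z else \<theta>0)" for z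
  have \<theta>hat_Q: "\<theta>hat \<in> measurable ?Q (rvec_borel p)"
    using \<theta>hat_meas measurable_cong_sets[OF sets_Q refl] by blast
  have \<theta>1_rvec: "\<theta>1 \<in> measurable ?Q (rvec_borel p)"
    unfolding \<theta>1_def using \<theta>0(1) \<Theta>_sub measurable_sets[OF \<theta>hat_Q \<Theta>_sets]
    by (intro measurable_If \<theta>hat_Q measurable_const) (auto simp: vimage_def Int_def conj_commute)
  have \<theta>1_meas [measurable]: "\<theta>1 \<in> measurable ?Q L"
    unfolding L_def by (rule measurable_restrict_space2[OF _ \<theta>1_rvec]) (auto simp: \<theta>1_def \<theta>0(1))
  \<comment> \<open>Maximality too is known only at attained samples, so nonnegativity of the
    criterion is made part of the event. At attained samples it holds because the criterion vanishes
    at \<open>\<theta>0\<close>, so the probability is unchanged.\<close>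
  define E where "E = {z \<in> space ?Q. eucl_dist p (\<theta>1 z) \<theta>0 > \<epsilon> \<and> U_stat n f z (\<theta>1 z) \<ge> 0}"
  have dist_meas [measurable]: "(\<lambda>z. eucl_dist p (\<theta>1 z) \<theta>0) \<in> borel_measurable ?Q"
    by (rule measurable_compose[OF \<theta>1_rvec borel_measurable_eucl_dist])
  have E_sets [measurable]: "E \<in> sets ?Q"
    unfolding E_def by measurable
  define T where "T z = (if z \<in> E then \<theta>1 z else \<theta>0)" for z
  have T_meas [measurable]: "T \<in> measurable ?Q L"
    unfolding T_def
  proof (rule measurable_If)
    have "{z \<in> space ?Q. z \<in> E} = E" by (auto simp: E_def)
    then show "{z \<in> space ?Q. z \<in> E} \<in> sets ?Q" using E_sets by simp
  qed (use \<theta>0(1) space_L \<theta>1_meas in auto)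
  have event: "measure M {\<omega> \<in> space M. eucl_dist p (\<theta>hat (sample n Z \<omega>)) \<theta>0 > \<epsilon>} = measure ?Q E"
  proof -
    have "measure ?Q E = measure (distr M ?Q (sample n Z)) E" by (simp add: distr_Q)
    also have "\<dots> = measure M (sample n Z -` E \<inter> space M)"
      by (rule measure_distr[OF sample_meas E_sets])
    also have "sample n Z -` E \<inter> space M = {\<omega> \<in> space M. eucl_dist p (\<theta>hat (sample n Z \<omega>)) \<theta>0 > \<epsilon>}"
    proof -
      have "sample n Z \<omega> \<in> E \<longleftrightarrow> eucl_dist p (\<theta>hat (sample n Z \<omega>)) \<theta>0 > \<epsilon>" if \<omega>: "\<omega> \<in> space M" for \<omega>
      proof -
        let ?z = "sample n Z \<omega>"
        have z: "?z \<in> space ?Q" by (rule measurable_space[OF sample_meas \<omega>])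
        have mem: "\<theta>hat ?z \<in> \<Theta>" and "\<not> U_stat n f ?z \<theta>0 > U_stat n f ?z (\<theta>hat ?z)"
          using \<theta>hat[OF \<omega>] \<theta>0(1) unfolding is_arg_max_def by auto
        then have "U_stat n f ?z (\<theta>hat ?z) \<ge> 0" using U_\<theta>0[OF z] by simp
        then show ?thesis using mem z by (simp add: E_def \<theta>1_def)
      qed
      then show ?thesis by auto
    qed
    finally show ?thesis ..
  qed
  have U_int: "integrable ?Q (\<lambda>z. U_stat n f z (T z) - kernel_mean (T z))"
  proof (intro Bochner_Integration.integrable_diff integrable_kernel_mean Q.prob_space_axioms T_meas)
    show "integrable ?Q (\<lambda>z. U_stat n f z (T z))"
      unfolding U_stat_def case_prod_unfold
      by (intro integrable_divide_zero Bochner_Integration.integrable_sum integrable_kernel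
          Q.prob_space_axioms measurable_component_singleton T_meas) auto
  qed
  have "\<xi> * measure ?Q E = (\<integral>z. \<xi> * indicator E z \<partial>?Q)"
    using sets.sets_into_space[OF E_sets] by (simp add: Int_absorb2)
  also have "\<dots> \<le> (\<integral>z. U_stat n f z (T z) - kernel_mean (T z) \<partial>?Q)"
  proof (rule integral_mono[OF _ U_int])
    show "integrable ?Q (\<lambda>z. \<xi> * indicator E z)"
      by (intro integrable_mult_right integrable_real_indicator E_sets)
        (simp add: Q.emeasure_finite less_top[symmetric])
    fix z assume z: "z \<in> space ?Q"
    show "\<xi> * indicator E z \<le> U_stat n f z (T z) - kernel_mean (T z)"
    proof (cases "z \<in> E")
      case True
      have \<theta>1: "\<theta>1 z \<in> \<Theta>" using \<theta>0(1) by (simp add: \<theta>1_def)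
      have "\<xi> \<le> kernel_mean \<theta>0 - kernel_mean (\<theta>1 z)"
        using sep(2)[OF \<theta>1] True \<theta>1 \<theta>0(1) by (simp add: \<Gamma> E_def)
      then show ?thesis using True by (simp add: T_def mean_\<theta>0 E_def)
    next
      case False
      then show ?thesis using U_\<theta>0[OF z] by (simp add: T_def mean_\<theta>0)
    qed
  qed
  finally have "real (n div 2) * (\<xi> * measure ?Q E)
      \<le> real (n div 2) * (\<integral>z. U_stat n f z (T z) - kernel_mean (T z) \<partial>?Q)"
    by (intro mult_left_mono) auto
  also have "\<dots> \<le> 2 * vc_rademacher_bound B K \<nu> (n div 2)"
    using vc unfolding space_P[symmetric] space_L[symmetric]
    by (intro U_process_selection_bound B(1) K n T_meas)
  finally show ?thesis unfolding event .
qed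

text \<open>\<open>K\<close> is fixed before \<open>n\<close> grows, so \<open>D\<close> may
  increase arbitrarily fast: \<open>K\<close> makes the first term less than \<open>e / 2\<close>,
  then \<open>n\<close> does so for the second.\<close>

lemma tendsto_zero_of_parametric_bound:
  fixes q r :: "nat \<Rightarrow> real"
  assumes "C \<ge> 0" "r \<longlonglongrightarrow> 0" and q: "\<And>n. n \<ge> n0 \<Longrightarrow> 0 \<le> q n"
    and bound: "\<And>n K. n \<ge> n0 \<Longrightarrow> K \<ge> 1 \<Longrightarrow> q n \<le> C / real K + D K * r n"
  shows "q \<longlonglongrightarrow> 0"
proof (rule LIMSEQ_I)
  fix e :: real assume e: "e > 0"
  obtain K :: nat where K: "max 1 (2 * C / e) < real K"
    using reals_Archimedean2 by blast
  then have K1: "K \<ge> 1" and "2 * C / e < real K" by auto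
  then have CK: "C / real K < e / 2" using e by (simp add: field_simps)
  have "(\<lambda>n. D K * r n) \<longlonglongrightarrow> 0" using tendsto_mult_left[OF assms(2), of "D K"] by simp
  then obtain n1 where n1: "\<And>n. n \<ge> n1 \<Longrightarrow> norm (D K * r n - 0) < e / 2"
    using LIMSEQ_D[of "\<lambda>n. D K * r n" 0 "e / 2"] e by auto
  have "norm (q n - 0) < e" if n: "n \<ge> max n0 n1" for n
  proof -
    have "D K * r n < e / 2" using n1[of n] n by (simp add: abs_less_iff)
    moreover have "q n \<le> C / real K + D K * r n" using bound K1 n by simp
    ultimately have "q n < e" using CK by linarith
    then show ?thesis using q[of n] n by simp
  qed
  then show "\<exists>n1. \<forall>n\<ge>n1. norm (q n - 0) < e" by blast
qed

theorem theorem2p2: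
  fixes m p \<nu> :: "nat \<Rightarrow> nat"
    and M :: "nat \<Rightarrow> 'w measure"
    and P :: "nat \<Rightarrow> rvec measure"
    and Z :: "nat \<Rightarrow> nat \<Rightarrow> 'w \<Rightarrow> rvec"
    and f :: "nat \<Rightarrow> rvec \<Rightarrow> rvec \<Rightarrow> rvec \<Rightarrow> real"
    and \<Theta> :: "nat \<Rightarrow> rvec set"
    and \<theta>0 :: "nat \<Rightarrow> rvec"
    and \<theta>hat :: "nat \<Rightarrow> (nat \<Rightarrow> rvec) \<Rightarrow> rvec"
  assumes prob_M: "\<And>n. n \<ge> 2 \<Longrightarrow> prob_space (M n)"
    and prob_P: "\<And>n. n \<ge> 2 \<Longrightarrow> prob_space (P n) \<and> sets (P n) = sets (rvec_borel (m n))"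
    and indep: "\<And>n. n \<ge> 2 \<Longrightarrow>
          prob_space.indep_vars (M n) (\<lambda>_. rvec_borel (m n)) (Z n) {..<n}"
    and ident: "\<And>n i. n \<ge> 2 \<Longrightarrow> i < n \<Longrightarrow> distr (M n) (rvec_borel (m n)) (Z n i) = P n"
    and f_measurable: "\<And>n. n \<ge> 2 \<Longrightarrow>
          (\<lambda>((z1, z2), \<theta>). f n z1 z2 \<theta>) \<in> borel_measurable
            ((rvec_borel (m n) \<Otimes>\<^sub>M rvec_borel (m n)) \<Otimes>\<^sub>M restrict_space (rvec_borel (p n)) (\<Theta> n))"
    and f_bounded: "\<exists>B. \<forall>n\<ge>2. \<forall>\<theta>\<in>\<Theta> n. \<forall>z1\<in>space (rvec_borel (m n)).
          \<forall>z2\<in>space (rvec_borel (m n)). \<bar>f n z1 z2 \<theta>\<bar> \<le> B"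
    and f_vc: "\<And>n. n \<ge> 2 \<Longrightarrow>
          vc_subgraph_class (space (rvec_borel (m n)) \<times> space (rvec_borel (m n)))
            ((\<lambda>\<theta> (z1, z2). f n z1 z2 \<theta>) ` \<Theta> n) (\<nu> n)"
    and \<theta>0_argmax: "\<And>n. n \<ge> 2 \<Longrightarrow>
          is_arg_max (expected_U_stat (M n) n (f n) (Z n)) (\<lambda>\<theta>. \<theta> \<in> \<Theta> n) (\<theta>0 n)"
    and f_\<theta>0: "\<And>n z1 z2. n \<ge> 2 \<Longrightarrow> z1 \<in> space (rvec_borel (m n)) \<Longrightarrow>
          z2 \<in> space (rvec_borel (m n)) \<Longrightarrow> f n z1 z2 (\<theta>0 n) = 0"
    and \<theta>hat_measurable: "\<And>n. n \<ge> 2 \<Longrightarrow>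
          \<theta>hat n \<in> measurable (PiM {..<n} (\<lambda>_. rvec_borel (m n))) (rvec_borel (p n))"
    and \<theta>hat_argmax: "\<And>n \<omega>. n \<ge> 2 \<Longrightarrow> \<omega> \<in> space (M n) \<Longrightarrow>
          is_arg_max (U_stat n (f n) (sample n (Z n) \<omega>)) (\<lambda>\<theta>. \<theta> \<in> \<Theta> n)
            (\<theta>hat n (sample n (Z n) \<omega>))"
    and A1_compact: "\<And>n. n \<ge> 2 \<Longrightarrow> compactin (rvec_top (p n)) (\<Theta> n)"
    and A1: "\<exists>r0>0.
          (\<forall>n\<ge>2. eucl_ball (p n) (\<theta>0 n) r0 \<subseteq> \<Theta> n) \<and>
          (\<forall>r. 0 < r \<and> r < r0 \<longrightarrow>
            (\<exists>\<xi>0>0. \<forall>n\<ge>2. \<forall>\<theta> \<in> \<Theta> n - eucl_ball (p n) (\<theta>0 n) r.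
               expected_U_stat (M n) n (f n) (Z n) (\<theta>0 n)
                 - expected_U_stat (M n) n (f n) (Z n) \<theta> \<ge> \<xi>0))"
    and A2_\<Gamma>: "\<And>n. n \<ge> 2 \<Longrightarrow>
          continuous_map (subtopology (rvec_top (p n)) (\<Theta> n)) euclideanreal
            (expected_U_stat (M n) n (f n) (Z n))"
    and A2_f: "\<And>n. n \<ge> 2 \<Longrightarrow>
          AE (z1, z2) in P n \<Otimes>\<^sub>M P n.
            topcontinuous_at (subtopology (rvec_top (p n)) (\<Theta> n)) euclideanreal
              (\<lambda>\<theta>. f n z1 z2 \<theta>) (\<theta>0 n)"
    and vc_rate: "(\<lambda>n. real (\<nu> n) / real n) \<longlonglongrightarrow> 0"
  shows "\<forall>\<epsilon>>0. (\<lambda>n. measure (M n)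
           {\<omega> \<in> space (M n). eucl_dist (p n) (\<theta>hat n (sample n (Z n) \<omega>)) (\<theta>0 n) > \<epsilon>})
         \<longlonglongrightarrow> 0"
proof (intro allI impI)
  fix \<epsilon> :: real assume \<epsilon>: "\<epsilon> > 0"
  define dev where "dev n = measure (M n) {\<omega> \<in> space (M n). eucl_dist (p n) (\<theta>hat n (sample n (Z n) \<omega>)) (\<theta>0 n) > \<epsilon>}" for n
  obtain B0 where B0: "\<And>n \<theta> z1 z2. n \<ge> 2 \<Longrightarrow> \<theta> \<in> \<Theta> n \<Longrightarrow> z1 \<in> space (rvec_borel (m n)) \<Longrightarrow>
      z2 \<in> space (rvec_borel (m n)) \<Longrightarrow> \<bar>f n z1 z2 \<theta>\<bar> \<le> B0"
    using f_bounded by blast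
  \<comment> \<open>\<open>B0\<close> may fail to be positive, but the spacing of the levels has to
    be.\<close>
  define B where "B = max 1 B0"
  have B: "0 < B" and B_bound: "\<And>n \<theta> z1 z2. n \<ge> 2 \<Longrightarrow> \<theta> \<in> \<Theta> n \<Longrightarrow> z1 \<in> space (rvec_borel (m n)) \<Longrightarrow>
      z2 \<in> space (rvec_borel (m n)) \<Longrightarrow> \<bar>f n z1 z2 \<theta>\<bar> \<le> B"
    using B0 by (auto simp: B_def le_max_iff_disj)
  obtain r0 where r0: "r0 > 0" and sep0: "\<And>r. 0 < r \<Longrightarrow> r < r0 \<Longrightarrow>
      \<exists>\<xi>0>0. \<forall>n\<ge>2. \<forall>\<theta> \<in> \<Theta> n - eucl_ball (p n) (\<theta>0 n) r.
        expected_U_stat (M n) n (f n) (Z n) (\<theta>0 n) - expected_U_stat (M n) n (f n) (Z n) \<theta> \<ge> \<xi>0"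
    using A1 by blast
  \<comment> \<open>(A1) gives separation only for radii strictly below \<open>r0\<close>, hence the
    halving. As \<open>r \<le> \<epsilon>\<close>, parameters farther than \<open>\<epsilon>\<close>
    from the centre lie outside the ball.\<close>
  define r where "r = min \<epsilon> (r0 / 2)"
  have "0 < r" "r < r0" "r \<le> \<epsilon>" using r0 \<epsilon> by (auto simp: r_def)
  then obtain \<xi> where \<xi>: "\<xi> > 0" and sep: "\<And>n \<theta>. n \<ge> 2 \<Longrightarrow> \<theta> \<in> \<Theta> n - eucl_ball (p n) (\<theta>0 n) r \<Longrightarrow>
        expected_U_stat (M n) n (f n) (Z n) (\<theta>0 n) - expected_U_stat (M n) n (f n) (Z n) \<theta> \<ge> \<xi>"
    using sep0[of r] by blast
  \<comment> \<open>With the symmetrization factor 2, \<open>vc_rademacher_bound\<close> gives the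
    constants \<open>12 = 2 * 2 * 3\<close> and \<open>8 = 2 * 2 * 2\<close>. The latter becomes 24
    through \<open>n \<le> 3 * (n div 2)\<close>, which is an equality at
    \<open>n = 3\<close>.\<close>
  have bound: "dev n \<le> 12 * B / \<xi> / real K + 24 * B * real K * ln (real K) / \<xi> * (real (\<nu> n) / real n)"
    if n: "n \<ge> 2" and K: "K \<ge> 1" for n K
  proof -
    define N where "N = n div 2"
    have \<theta>0_mem: "\<theta>0 n \<in> \<Theta> n" using \<theta>0_argmax[OF n] by (simp add: is_arg_max_def)
    have "real N * (\<xi> * dev n) \<le> 2 * vc_rademacher_bound B K (\<nu> n) N"
      unfolding dev_def N_def
    proof (rule argmax_deviation_bound[where S = "rvec_borel (m n)" and P = "P n" and f = "f n" and \<Theta> = "\<Theta> n"])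
      show "expected_U_stat (M n) n (f n) (Z n) (\<theta>0 n) - expected_U_stat (M n) n (f n) (Z n) \<theta> \<ge> \<xi>"
        if "\<theta> \<in> \<Theta> n" "eucl_dist (p n) \<theta> (\<theta>0 n) > \<epsilon>" for \<theta>
        using that \<open>r \<le> \<epsilon>\<close> by (intro sep n) (auto simp: eucl_ball_def)
    qed (use n K B \<xi> \<theta>0_mem prob_M[OF n] prob_P[OF n] in
        \<open>auto intro: indep ident f_measurable B_bound f_vc f_\<theta>0 \<theta>hat_measurable \<theta>hat_argmax A1_compact\<close>)
    moreover have "2 * vc_rademacher_bound B K (\<nu> n) N
        = real N * (12 * B / real K) + 8 * B * real K * ln (real K) * real (\<nu> n)"
      by (simp add: vc_rademacher_bound_def algebra_simps)
    ultimately have main: "real N * (\<xi> * dev n) \<le> real N * (12 * B / real K) + 8 * B * real K * ln (real K) * real (\<nu> n)"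
      by simp
    have "n \<le> 3 * N" using n unfolding N_def by presburger
    then have N: "real n \<le> 3 * real N" by linarith
    have N0: "real N > 0" "real n > 0" using N n by linarith+
    have "8 * B * real K * ln (real K) * real (\<nu> n) = real n * (8 * B * real K * ln (real K) * (real (\<nu> n) / real n))"
      using N0 by simp
    also have "\<dots> \<le> (3 * real N) * (8 * B * real K * ln (real K) * (real (\<nu> n) / real n))"
      using B K by (intro mult_right_mono N mult_nonneg_nonneg) auto
    finally have "real N * (\<xi> * dev n) \<le> real N * (12 * B / real K + 24 * B * real K * ln (real K) * (real (\<nu> n) / real n))"
      using main by (simp add: algebra_simps)
    then have "\<xi> * dev n \<le> 12 * B / real K + 24 * B * real K * ln (real K) * (real (\<nu> n) / real n)"
      using N0 by (simp only: mult_le_cancel_left_pos)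
    then have "dev n \<le> (12 * B / real K + 24 * B * real K * ln (real K) * (real (\<nu> n) / real n)) / \<xi>"
      using \<xi> by (simp add: pos_le_divide_eq mult.commute)
    then show ?thesis by (simp add: add_divide_distrib mult.commute divide_divide_eq_left)
  qed
  have "dev \<longlonglongrightarrow> 0"
    by (rule tendsto_zero_of_parametric_bound[OF _ vc_rate _ bound])
      (use B \<xi> in \<open>auto simp: dev_def\<close>)
  then show "(\<lambda>n. measure (M n) {\<omega> \<in> space (M n). eucl_dist (p n) (\<theta>hat n (sample n (Z n) \<omega>)) (\<theta>0 n) > \<epsilon>}) \<longlonglongrightarrow> 0"
    unfolding dev_def .
qed

end
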